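(* Let $F_{\bar P}:\mathbb S\times\mathbb S\setminus\Delta\to\mathbb S\times\mathbb S\setminus\Delta$ be the two-dimensional Bowen–Series map $F_{\bar P}(x,y)=(T_ix,T_iy)$ if $y\in[P_i,P_{i+1})$. Then: (1) $F_{\bar P}$ possesses a bijectivity domain $\Omega$ (i.e. $F_{\bar P}$ maps $\Omega$ bijectively onto itself) having a finite rectangular structure; and (2) every point $(x,y)\in\mathbb S\times\mathbb S\setminus\Delta$ is mapped into $\Omega$ after finitely many iterations of $F_{\bar P}$.
   Context: Setting. Fix $g\ge 2$. Work in the Poincaré unit disk $\mathbb D$ with hyperbolic metric; let $\mathbb S$ be the unit circle and $\Delta=\{(x,x):x\in\mathbb S\}$. Let $\mathcal F$ be the regular hyperbolic $(8g-4)$-gon centered at $0$ with all interior angles $\pi/2$ (fundamental domain of a cocompact torsion-free Fuchsian group of genus $g$). Indices are mod $8g-4$. Label the sides $1,\dots,8g-4$ counterclockwise, vertices $V_i$ with side $i$ joining $V_i$ to $V_{i+1}$. The complete geodesic extending side $i$ goes from $P_i\in\mathbb S$ (beyond $V_i$) to $Q_{i+1}\in\mathbb S$ (beyond $V_{i+1}$); counterclockwise order on $\mathbb S$: $P_1,Q_1,P_2,Q_2,\dots,P_{8g-4},Q_{8g-4}$. Let $\sigma(i)=4g-i$ ($i$ odd), $\sigma(i)=2-i$ ($i$ even). $T_i$ is the Möbius transformation of $\mathbb D$ mapping side $i$ onto side $\sigma(i)$, with isometric circle the geodesic $P_iQ_{i+1}$, mapping it onto the geodesic $Q_{\sigma(i)+1}P_{\sigma(i)}$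 (inside to outside), with $T_{\sigma(i)}T_i=\mathrm{Id}$. Arcs $[A,B)$ etc. are counterclockwise from $A$ to $B$. A set has finite rectangular structure if (in angular coordinates) it is bounded by non-decreasing step functions with a finite number of steps. *)

theory Defs
  imports "HOL-Analysis.Analysis"
begin

definition circ :: "complex set" where "circ = sphere 0 1"

definition phase :: "(complex \<times> complex) set" where
  "phase = {(x, y). x \<in> circ \<and> y \<in> circ \<and> x \<noteq> y}"

definition ccw_angle :: "complex \<Rightarrow> complex \<Rightarrow> real" where
  "ccw_angle A z = (let t = Arg (z / A) in if t < 0 then t + 2 * pi else t)"

definition arc_co :: "complex \<Rightarrow> complex \<Rightarrow> complex set" where
  "arc_co A B = {z \<in> circ. ccw_angle A z < ccw_angle A B}"

definition nsides :: "nat \<Rightarrow> nat" where "nsides g = 8 * g - 4"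

text \<open>Direction of the midpoint of side i (vertex V_i lies at angle 2 pi (i-1)/N).
  Everything is 2 pi-periodic in i mod N, so indices are taken in int.\<close>
definition midang :: "nat \<Rightarrow> int \<Rightarrow> real" where
  "midang g i = 2 * pi * (real_of_int i - 1/2) / real (nsides g)"

text \<open>Half angular width of the complete geodesic extending a side: for the regular
  N-gon with interior angles pi/2 one has cos(halfw) = sqrt (cos (2 pi / N)).\<close>
definition halfw :: "nat \<Rightarrow> real" where
  "halfw g = arccos (sqrt (cos (2 * pi / real (nsides g))))"

definition Pt :: "nat \<Rightarrow> int \<Rightarrow> complex" where
  "Pt g i = cis (midang g i - halfw g)"

definition Qt :: "nat \<Rightarrow> int \<Rightarrow> complex" where
  "Qt g i = cis (midang g (i - 1) + halfw g)"

text \<open>Euclidean center distance R and radius r of the side geodesics (isometric circles).\<close>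
definition Rc :: "nat \<Rightarrow> real" where "Rc g = 1 / cos (halfw g)"
definition rc :: "nat \<Rightarrow> real" where "rc g = tan (halfw g)"

definition sigma :: "nat \<Rightarrow> int \<Rightarrow> int" where
  "sigma g i = (if odd i then 4 * int g - i else 2 - i)"

text \<open>T_i(z) = (a z + b)/(cnj b z + cnj a) with |a|^2-|b|^2 = 1; its isometric circle
  is centred at -cnj a / cnj b = R cis(midang i) with radius 1/|b| = r (geodesic P_i Q_(i+1)),
  and that of its inverse is centred at a / cnj b = R cis(midang (sigma i)).\<close>
definition Ta :: "nat \<Rightarrow> int \<Rightarrow> complex" where
  "Ta g i = complex_of_real (Rc g / rc g) *
     cis ((midang g (sigma g i) - midang g i - pi) / 2)"

definition Tb :: "nat \<Rightarrow> int \<Rightarrow> complex" where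
  "Tb g i = complex_of_real (1 / rc g) *
     cis ((midang g (sigma g i) + midang g i + pi) / 2)"

definition Tmap :: "nat \<Rightarrow> int \<Rightarrow> complex \<Rightarrow> complex" where
  "Tmap g i z = (Ta g i * z + Tb g i) / (cnj (Tb g i) * z + cnj (Ta g i))"

definition BS_map :: "nat \<Rightarrow> complex \<times> complex \<Rightarrow> complex \<times> complex" where
  "BS_map g p = (let i = (THE i. i \<in> {1..int (nsides g)} \<and> snd p \<in> arc_co (Pt g i) (Pt g (i + 1)))
                 in (Tmap g i (fst p), Tmap g i (snd p)))"

text \<open>Finite rectangular structure: in angular coordinates x = cis s with s \<in> [t0, t0+2pi)
  and y = cis t with t lifted into (s, s+2pi), the set is bounded below and above by
  non-decreasing step functions with finitely many steps (monotone, finite range).\<close>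
definition finite_rect_structure :: "(complex \<times> complex) set \<Rightarrow> bool" where
  "finite_rect_structure \<Omega> \<longleftrightarrow>
    (\<exists>t0 (l :: real \<Rightarrow> real) (u :: real \<Rightarrow> real).
       mono_on {t0..<t0 + 2 * pi} l \<and> mono_on {t0..<t0 + 2 * pi} u \<and>
       finite (l ` {t0..<t0 + 2 * pi}) \<and> finite (u ` {t0..<t0 + 2 * pi}) \<and>
       (\<forall>s \<in> {t0..<t0 + 2 * pi}. \<forall>t \<in> {s<..<s + 2 * pi}.
          (l s < t \<and> t < u s \<longrightarrow> (cis s, cis t) \<in> \<Omega>) \<and>
          ((cis s, cis t) \<in> \<Omega> \<longrightarrow> l s \<le> t \<and> t \<le> u s)))"

end

theory Submission
  imports Defs
begin

text \<open>
  On lifts to the real line all side pairings are, up to rotations, one circle homeomorphism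
  \<open>\<phi>\<close>, which permutes the endpoints \<open>P\<^sub>i\<close>, \<open>Q\<^sub>i\<close> nearest to the paired sides. Coding angles by
  the arcs between consecutive endpoints turns the bijectivity of the map on
  \<open>\<Omega> = \<Union>\<^sub>j [Q\<^bsub>j+2\<^esub>, P\<^bsub>j-1\<^esub>) \<times> [P\<^sub>j, Q\<^sub>j) \<union> [Q\<^bsub>j+2\<^esub>, P\<^sub>j) \<times> [Q\<^sub>j, P\<^bsub>j+1\<^esub>)\<close>
  into integer arithmetic; the inverse there applies \<open>T\<^sub>k\<close> when \<open>x \<in> [Q\<^sub>k, Q\<^bsub>k+1\<^esub>)\<close>.
  An orbit outside \<open>\<Omega>\<close> has \<open>x\<close> close to \<open>y\<close>. Since \<open>\<phi>\<close> expands distances strictly inside the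
  isometric circle, it cannot keep both points there, nor keep \<open>y\<close> beside the endpoint that the
  current side pairings fix, so it reaches \<open>\<Omega>\<close>.
\<close>

text \<open>Engine of the attraction arguments: while an orbit stays in the bad region
  \<open>P\<close>, a quantity bounded there gains at least \<open>\<eta>\<close> per step, so it
  must leave. The induction counts how many gains still fit below \<open>V\<close>.\<close>

lemma growth_induct:
  fixes v :: "'a \<Rightarrow> 'b \<Rightarrow> real"
  assumes "\<eta> > 0" and bound: "\<And>x y. P x y \<Longrightarrow> v x y \<le> V"
    and step: "\<And>x y. P x y \<Longrightarrow> (\<And>x' y'. P x' y' \<Longrightarrow> v x y + \<eta> \<le> v x' y' \<Longrightarrow> Q x' y') \<Longrightarrow> Q x y"
    and "P x y"
  shows "Q x y"
proof -
  have "P x y \<Longrightarrow> V - v x y < real n * \<eta> \<Longrightarrow> Q x y" for n x y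
  proof (induction n arbitrary: x y)
    case 0
    then show ?case using bound[of x y] by simp
  next
    case (Suc n)
    show ?case
    proof (rule step[OF Suc.prems(1)])
      fix x' y' assume "P x' y'" "v x y + \<eta> \<le> v x' y'"
      then show "Q x' y'" using Suc by (intro Suc.IH) (simp_all add: algebra_simps)
    qed
  qed
  moreover obtain n :: nat where "V - v x y < real n * \<eta>"
    using reals_Archimedean3[OF \<open>\<eta> > 0\<close>] by blast
  ultimately show ?thesis using \<open>P x y\<close> by blast
qed

section \<open>Angles of the regular polygon\<close>

locale bowen_series =
  fixes g :: nat
  assumes genus: "g \<ge> 2"
begin

definition N :: int where "N = int (nsides g)"
definition \<delta> :: real where "\<delta> = 2 * pi / real_of_int N"
definition h :: real where "h = halfw g"
definition R :: real where "R = Rc g"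
definition \<mu> :: "int \<Rightarrow> real" where "\<mu> i = midang g i"
text \<open>\<open>p\<close> and \<open>q\<close> lift the endpoints P_i and Q_i to the real line.
  Indices are not reduced, so adding \<open>N\<close> to an index is one full turn.\<close>

definition p :: "int \<Rightarrow> real" where "p i = \<mu> i - h"
definition q :: "int \<Rightarrow> real" where "q i = \<mu> (i - 1) + h"

lemma N_ge: "N \<ge> 12" and even_N: "even N"
  using genus by (auto simp: N_def nsides_def)

lemma delta_pos: "\<delta> > 0" and delta_le: "\<delta> \<le> pi / 6" and N_delta: "real_of_int N * \<delta> = 2 * pi"
proof -
  have N12: "real_of_int N \<ge> 12" using N_ge by linarith
  then show "\<delta> > 0" "real_of_int N * \<delta> = 2 * pi" by (auto simp: \<delta>_def)
  show "\<delta> \<le> pi / 6" using N12 by (auto simp: \<delta>_def field_simps)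
qed

lemma mu_eq: "\<mu> i = (real_of_int i - 1/2) * \<delta>"
  by (simp add: \<mu>_def midang_def \<delta>_def N_def)

lemma cos_delta_bounds: "0 < cos \<delta>" "cos \<delta> < 1"
proof -
  show "0 < cos \<delta>" using delta_pos delta_le pi_gt_zero by (intro cos_gt_zero) linarith+
  show "cos \<delta> < 1" using delta_pos delta_le cos_monotone_0_pi[of 0 \<delta>] pi_gt_zero by simp
qed

text \<open>Orthogonality of neighbouring side circles,
  \<open>2 * R\<^sup>2 * (1 - cos \<delta>) = 2 * (R\<^sup>2 - 1)\<close>, amounts to the second
  identity. This is how the interior angles pi/2 enter.\<close>

lemma cos_h: "cos h = sqrt (cos \<delta>)" and cos_h_sq: "cos h * cos h = cos \<delta>"
  and h_range: "0 \<le> h" "h \<le> pi"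
proof -
  have *: "h = arccos (sqrt (cos \<delta>))" by (simp add: h_def halfw_def \<delta>_def N_def)
  have b: "-1 \<le> sqrt (cos \<delta>)" "sqrt (cos \<delta>) \<le> 1"
    using cos_delta_bounds by (auto simp: order_trans[of _ 0])
  show c: "cos h = sqrt (cos \<delta>)" unfolding * using b by (simp add: cos_arccos)
  show "cos h * cos h = cos \<delta>" unfolding c using cos_delta_bounds by simp
  show "0 \<le> h" "h \<le> pi" unfolding * using b by (auto intro: arccos_lbound arccos_ubound)
qed

lemma cos_h_pos: "cos h > 0"
  using cos_h cos_delta_bounds by simp

lemma h_less_delta: "h < \<delta>"
proof -
  have "cos \<delta> * cos \<delta> < cos h * cos h" unfolding cos_h_sq using cos_delta_bounds by simp
  then have "cos \<delta> < cos h" using cos_h_pos cos_delta_bounds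
    by (meson mult_mono' not_less less_imp_le)
  then show ?thesis using cos_mono_less_eq[of \<delta> h] h_range delta_pos delta_le pi_gt_zero
    by simp
qed

text \<open>Together with \<open>h_less_delta\<close> this gives the cyclic order P_i, Q_i, P_(i+1).
  With c = cos (\<delta>/2) < 1, \<open>cos h * cos h\<close> equals 2c^2 - 1 < c^2.\<close>

lemma half_delta_less_h: "\<delta> / 2 < h"
proof -
  have c: "cos \<delta> = 2 * (cos (\<delta>/2))\<^sup>2 - 1" using cos_double_cos[of "\<delta>/2"] by simp
  have pos: "0 < cos (\<delta>/2)" using delta_pos delta_le by (intro cos_gt_zero) (use pi_gt_zero in linarith)+
  have l1: "cos (\<delta>/2) < 1" using cos_monotone_0_pi[of 0 "\<delta>/2"] delta_pos delta_le pi_gt_zero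
    by simp
  have "(cos (\<delta>/2))\<^sup>2 < 1\<^sup>2" using pos l1 by (intro power_strict_mono) auto
  then have "cos h * cos h < cos (\<delta>/2) * cos (\<delta>/2)" unfolding cos_h_sq c
    by (simp add: power2_eq_square)
  then have "cos h < cos (\<delta>/2)" using cos_h_pos pos
    by (meson mult_mono' not_less less_imp_le)
  then show ?thesis using cos_mono_less_eq[of h "\<delta>/2"] h_range delta_pos delta_le pi_gt_zero
    by simp
qed

text \<open>Needed for \<open>vertex_cos_ineq\<close>. With u = cos (\<delta>/2),
  \<open>2 * cos \<delta>\<close> minus \<open>2 * (cos (3 * \<delta> / 4))\<^sup>2\<close> factors
  as (1 - u)(4u^2 - 3), which is nonnegative because \<delta>/2 is at most pi/6.\<close>

lemma h_le: "h \<le> 3 * \<delta> / 4"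
proof -
  define u where "u = cos (\<delta>/2)"
  have "cos (\<delta>/2) \<ge> cos (pi/6)"
    using delta_pos delta_le pi_gt_zero by (intro cos_monotone_0_pi_le) linarith+
  then have u: "u \<ge> sqrt 3 / 2" by (simp add: u_def cos_30)
  then have "u\<^sup>2 \<ge> (sqrt 3 / 2)\<^sup>2" by (intro power_mono) auto
  then have u2: "4 * u\<^sup>2 - 3 \<ge> 0" by (simp add: power_divide)
  have "u \<le> 1" by (simp add: u_def)
  then have *: "(1 - u) * (4 * u\<^sup>2 - 3) \<ge> 0" using u2 by simp
  have cd: "cos \<delta> = 2 * u\<^sup>2 - 1" using cos_double_cos[of "\<delta>/2"] by (simp add: u_def)
  have "cos (3 * (\<delta>/2)) = 4 * u ^ 3 - 3 * u" using cos_treble_cos[of "\<delta>/2"] by (simp add: u_def)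
  moreover have "cos (3 * (\<delta>/2)) = 2 * (cos (3 * \<delta> / 4))\<^sup>2 - 1"
    using cos_double_cos[of "3 * \<delta> / 4"] by simp
  ultimately have "2 * (cos (3 * \<delta> / 4))\<^sup>2 = 4 * u ^ 3 - 3 * u + 1" by simp
  also have "\<dots> \<le> 2 * cos \<delta>" using * unfolding cd
    by (simp add: algebra_simps power2_eq_square power3_eq_cube)
  finally have le: "cos (3 * \<delta> / 4) * cos (3 * \<delta> / 4) \<le> cos h * cos h"
    unfolding cos_h_sq by (simp add: power2_eq_square)
  have "cos (3 * \<delta> / 4) \<le> cos h"
    by (metis le cos_h_pos linorder_not_le mult_strict_mono' less_imp_le)
  then show ?thesis using cos_mono_le_eq[of "3 * \<delta> / 4" h] h_range delta_pos delta_le pi_gt_zero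
    by simp
qed

lemma h_pos: "h > 0" and h_less_pi: "2 * h < pi"
  using half_delta_less_h h_less_delta delta_pos delta_le pi_gt_zero by linarith+

lemma R_eq: "R = 1 / cos h" by (simp add: R_def Rc_def h_def)

lemma R_gt_1: "R > 1"
  using h_less_delta h_pos h_less_pi cos_monotone_0_pi[of 0 h] cos_h_pos by (simp add: R_eq)

subsection \<open>The side pairings in angular coordinates\<close>

text \<open>A continuous lift of w -> (R w - 1)/(w - R) on the unit circle, see
  \<open>cis_phi\<close>. With angles measured from the midpoint of side i before, and of side
  \<sigma>(i) after, every T_i is this one map.\<close>

definition \<phi> :: "real \<Rightarrow> real" where
  "\<phi> \<theta> = pi + \<theta> + 2 * arctan (sin \<theta> / (R - cos \<theta>))"

lemma R_minus_cos_pos: "R - cos \<theta> > 0"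
  using R_gt_1 cos_le_one[of \<theta>] by linarith

lemma phi_add: "\<phi> (\<theta> + 2 * pi * of_int k) = \<phi> \<theta> + 2 * pi * of_int k"
proof -
  have "sin (\<theta> + 2 * pi * of_int k) = sin \<theta>" "cos (\<theta> + 2 * pi * of_int k) = cos \<theta>"
    using sin_int_2pin[of k] cos_int_2pin[of k] by (simp_all add: sin_add cos_add)
  then show ?thesis by (simp add: \<phi>_def)
qed

lemma phi_minus: "\<phi> (- \<theta>) = 2 * pi - \<phi> \<theta>"
  by (simp add: \<phi>_def arctan_minus)

lemma phi_denominator_pos: "R\<^sup>2 + 1 - 2 * R * cos \<theta> > 0"
proof -
  have "(R - 1)\<^sup>2 > 0" using R_gt_1 by simp
  moreover have "R * cos \<theta> \<le> R * 1" using R_gt_1 by (intro mult_left_mono) auto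
  ultimately show ?thesis by (simp add: power2_eq_square algebra_simps)
qed

text \<open>Since \<open>R = 1 / cos h\<close>, the numerator is positive exactly when
  \<open>cos \<theta> > cos h\<close>: strictly inside the isometric circle \<open>\<phi>\<close>
  has slope above 1.\<close>

lemma phi_displacement_deriv:
  "((\<lambda>\<theta>. \<phi> \<theta> - \<theta>) has_real_derivative 2 * (R * cos \<theta> - 1) / (R\<^sup>2 + 1 - 2 * R * cos \<theta>)) (at \<theta>)"
proof -
  have nz: "R - cos \<theta> \<noteq> 0" using R_minus_cos_pos[of \<theta>] by simp
  have s: "sin \<theta> * sin \<theta> = 1 - cos \<theta> * cos \<theta>"
    using sin_squared_eq[of \<theta>] by (simp add: power2_eq_square)
  have den: "1 + (sin \<theta> / (R - cos \<theta>))\<^sup>2 = (R\<^sup>2 + 1 - 2 * R * cos \<theta>) / (R - cos \<theta>)\<^sup>2"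
  proof -
    have "(R - cos \<theta>)\<^sup>2 + sin \<theta> * sin \<theta> = R\<^sup>2 + 1 - 2 * R * cos \<theta>"
      by (simp add: power2_eq_square algebra_simps s)
    then show ?thesis using nz by (simp add: divide_simps power2_eq_square)
  qed
  have num: "(cos \<theta> * (R - cos \<theta>) - sin \<theta> * sin \<theta>) / ((R - cos \<theta>) * (R - cos \<theta>))
      = (R * cos \<theta> - 1) / (R - cos \<theta>)\<^sup>2"
    by (simp add: s power2_eq_square algebra_simps)
  have "((\<lambda>\<theta>. \<phi> \<theta> - \<theta>) has_real_derivative
     2 * (inverse (1 + (sin \<theta> / (R - cos \<theta>))\<^sup>2) *
       ((cos \<theta> * (R - cos \<theta>) - sin \<theta> * sin \<theta>) / ((R - cos \<theta>) * (R - cos \<theta>))))) (at \<theta>)"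
    unfolding \<phi>_def using nz
    by (auto intro!: derivative_eq_intros simp: algebra_simps)
  note D = this
  have frac: "2 * (inverse (A / B) * (C / B)) = 2 * C / A" if "B \<noteq> 0" for A B C :: real
    using that by (simp add: field_simps)
  have "(R - cos \<theta>)\<^sup>2 \<noteq> 0" using nz by simp
  then show ?thesis using D unfolding den num by (subst (asm) frac)
qed

lemma phi_strict_mono: "a < b \<Longrightarrow> \<phi> a < \<phi> b"
proof (rule DERIV_pos_imp_increasing[where f = \<phi>])
  fix x
  have "(\<phi> has_real_derivative 2 * (R * cos x - 1) / (R\<^sup>2 + 1 - 2 * R * cos x) + 1) (at x)"
    using DERIV_add[OF phi_displacement_deriv[of x] DERIV_ident] by simp
  moreover have "2 * (R * cos x - 1) / (R\<^sup>2 + 1 - 2 * R * cos x) + 1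
      = (R\<^sup>2 - 1) / (R\<^sup>2 + 1 - 2 * R * cos x)"
    using phi_denominator_pos[of x] by (simp add: field_simps)
  moreover have "(R\<^sup>2 - 1) / (R\<^sup>2 + 1 - 2 * R * cos x) > 0"
    using phi_denominator_pos[of x] R_gt_1 by simp
  ultimately show "\<exists>y. (\<phi> has_real_derivative y) (at x) \<and> 0 < y" by metis
qed

lemma phi_le_iff: "\<phi> a \<le> \<phi> b \<longleftrightarrow> a \<le> b"
  using phi_strict_mono by (metis linorder_less_linear order_less_asym order_le_less)

lemma phi_displacement_mono:
  assumes "- h \<le> a" "a < b" "b \<le> h"
  shows "\<phi> a - a < \<phi> b - b"
proof (rule DERIV_pos_imp_increasing_open[OF assms(2)])
  fix x assume "a < x" "x < b"
  then have "\<bar>x\<bar> < h" using assms by linarith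
  then have "cos h < cos \<bar>x\<bar>" using h_less_pi by (intro cos_monotone_0_pi) linarith+
  then have "R * cos h < R * cos x" using R_gt_1 by simp
  then have "R * cos x > 1" using cos_h_pos by (simp add: R_eq)
  then have "2 * (R * cos x - 1) / (R\<^sup>2 + 1 - 2 * R * cos x) > 0"
    using phi_denominator_pos[of x] by simp
  then show "\<exists>y. ((\<lambda>\<theta>. \<phi> \<theta> - \<theta>) has_real_derivative y) (at x) \<and> 0 < y"
    using phi_displacement_deriv by blast
next
  show "continuous_on {a..b} (\<lambda>\<theta>. \<phi> \<theta> - \<theta>)"
    by (auto intro!: continuous_at_imp_continuous_on DERIV_isCont[OF phi_displacement_deriv])
qed

text \<open>The slope is 1 at the ends -h and h, so no expansion factor above 1 is uniform. Yet the
  gain of an interval of length exactly \<epsilon> is positive and continuous, so by compactness it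
  has a positive minimum, and a longer interval gains at least as much.\<close>

lemma phi_expansion:
  assumes "\<epsilon> > 0"
  obtains \<eta> where "\<eta> > 0"
    "\<And>a b. - h \<le> a \<Longrightarrow> a + \<epsilon> \<le> b \<Longrightarrow> b \<le> h \<Longrightarrow> \<phi> b - \<phi> a \<ge> b - a + \<eta>"
proof (cases "- h \<le> h - \<epsilon>")
  case False
  \<comment> \<open>Here \<epsilon> exceeds 2h, so no such pair exists and any positive constant
    serves.\<close>
  then show ?thesis using that[of 1] by force
next
  case True
  define D where "D = (\<lambda>a. (\<phi> (a + \<epsilon>) - (a + \<epsilon>)) - (\<phi> a - a))"
  have cont: "continuous_on UNIV (\<lambda>\<theta>. \<phi> \<theta> - \<theta>)"
    by (auto intro!: continuous_at_imp_continuous_on DERIV_isCont[OF phi_displacement_deriv])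
  have "continuous_on {-h..h-\<epsilon>} D" unfolding D_def
    by (intro continuous_on_diff[OF continuous_on_compose2[OF cont, of _ "\<lambda>a. a + \<epsilon>"]]
        continuous_on_subset[OF cont] continuous_intros) auto
  then obtain x where x: "x \<in> {-h..h-\<epsilon>}" "\<And>y. y \<in> {-h..h-\<epsilon>} \<Longrightarrow> D x \<le> D y"
    using continuous_attains_inf[of "{-h..h-\<epsilon>}" D] True by auto
  show ?thesis
  proof (rule that[of "D x"])
    show "D x > 0" using x assms phi_displacement_mono[of x "x+\<epsilon>"] by (simp add: D_def)
    fix a b assume ab: "- h \<le> a" "a + \<epsilon> \<le> b" "b \<le> h"
    have "D x \<le> D a" using x(2)[of a] ab by simp
    moreover have "\<phi> (a+\<epsilon>) - (a+\<epsilon>) \<le> \<phi> b - b"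
      using ab assms phi_displacement_mono[of "a+\<epsilon>" b] by (cases "a + \<epsilon> = b") auto
    ultimately show "\<phi> b - \<phi> a \<ge> b - a + D x" by (simp add: D_def)
  qed
qed

section \<open>Images of endpoints and vertex directions\<close>

text \<open>With \<gamma> = (x + y)/2 in (0, pi), the condition reads cot \<gamma> \<le> sin x / (R
  - cos x). Clearing denominators with \<open>R = 1 / cos h\<close> makes it symmetric in x and y,
  without arctan.\<close>

lemma phi_minus_compare:
  assumes "0 < x + y" "x + y < 2 * pi"
  shows "\<phi> (- x) \<le> y \<longleftrightarrow> cos ((x + y) / 2) \<le> cos h * cos ((x - y) / 2)"
    and "\<phi> (- x) = y \<longleftrightarrow> cos ((x + y) / 2) = cos h * cos ((x - y) / 2)"
proof -
  define \<gamma> where "\<gamma> = (x + y) / 2"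
  have g: "0 < \<gamma>" "\<gamma> < pi" using assms by (auto simp: \<gamma>_def)
  have sg: "sin \<gamma> > 0" using g by (rule sin_gt_zero)
  have xg: "(x - y) / 2 = x - \<gamma>" by (simp add: \<gamma>_def field_simps)
  have at: "arctan (cos \<gamma> / sin \<gamma>) = pi / 2 - \<gamma>"
    using arctan_unique[of "pi/2 - \<gamma>"] g by (simp add: tan_def cos_diff sin_diff)
  have e: "cos h * cos (x - \<gamma>) - cos \<gamma> = cos h * (sin x * sin \<gamma> - cos \<gamma> * (R - cos x))"
    using cos_h_pos by (simp add: R_eq cos_diff algebra_simps)
  have c1: "cos \<gamma> / sin \<gamma> \<le> sin x / (R - cos x) \<longleftrightarrow> 0 \<le> sin x * sin \<gamma> - cos \<gamma> * (R - cos x)"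
    using sg R_minus_cos_pos[of x] by (simp add: divide_le_eq pos_le_divide_eq mult.commute)
  have c2: "cos \<gamma> / sin \<gamma> = sin x / (R - cos x) \<longleftrightarrow> 0 = sin x * sin \<gamma> - cos \<gamma> * (R - cos x)"
    using sg R_minus_cos_pos[of x] by (auto simp: frac_eq_eq)
  have "\<phi> (- x) \<le> y \<longleftrightarrow> pi / 2 - \<gamma> \<le> arctan (sin x / (R - cos x))"
    by (simp add: \<phi>_def arctan_minus \<gamma>_def field_simps)
  also have "\<dots> \<longleftrightarrow> cos \<gamma> / sin \<gamma> \<le> sin x / (R - cos x)"
    unfolding at[symmetric] by (rule arctan_le_iff)
  also have "\<dots> \<longleftrightarrow> cos \<gamma> \<le> cos h * cos (x - \<gamma>)"
    using c1 e cos_h_pos by (metis diff_ge_0_iff_ge zero_le_mult_iff less_imp_le not_less)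
  finally show "\<phi> (- x) \<le> y \<longleftrightarrow> cos ((x + y) / 2) \<le> cos h * cos ((x - y) / 2)"
    by (simp add: xg \<gamma>_def)
  have "\<phi> (- x) = y \<longleftrightarrow> pi / 2 - \<gamma> = arctan (sin x / (R - cos x))"
    by (auto simp: \<phi>_def arctan_minus \<gamma>_def field_simps)
  also have "\<dots> \<longleftrightarrow> cos \<gamma> / sin \<gamma> = sin x / (R - cos x)"
    unfolding at[symmetric] by (rule arctan_eq_iff)
  also have "\<dots> \<longleftrightarrow> cos \<gamma> = cos h * cos (x - \<gamma>)"
  proof -
    have "cos h * cos (x - \<gamma>) - cos \<gamma> = 0 \<longleftrightarrow> sin x * sin \<gamma> - cos \<gamma> * (R - cos x) = 0"
      unfolding e using cos_h_pos by simp
    then show ?thesis using c2 by argo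
  qed
  finally show "\<phi> (- x) = y \<longleftrightarrow> cos ((x + y) / 2) = cos h * cos ((x - y) / 2)"
    by (simp add: xg \<gamma>_def)
qed

text \<open>The angles -h, -\<delta>-h, h-\<delta> belong to P_i, P_(i-1), Q_i. The criterion
  becomes cos h = cos h cos 0 for the first, and cos \<delta> = cos h cos h for the other
  two.\<close>

lemma phi_values_neg:
  "\<phi> (- h) = h" "\<phi> (- \<delta> - h) = \<delta> - h" "\<phi> (h - \<delta>) = \<delta> + h"
proof -
  show "\<phi> (- h) = h" using phi_minus_compare(2)[of h h] h_pos h_less_pi by simp
  have "\<delta> < pi" using delta_le pi_gt_zero by linarith
  then show "\<phi> (- \<delta> - h) = \<delta> - h" "\<phi> (h - \<delta>) = \<delta> + h"
    using phi_minus_compare(2)[of "\<delta> + h" "\<delta> - h"] phi_minus_compare(2)[of "\<delta> - h" "\<delta> + h"]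
      delta_pos cos_h_sq by (simp_all add: algebra_simps)
qed

lemma phi_values_pos:
  "\<phi> h = 2 * pi - h" "\<phi> (\<delta> + h) = 2 * pi - \<delta> + h" "\<phi> (\<delta> - h) = 2 * pi - \<delta> - h"
  using phi_minus[of "- h"] phi_minus[of "- \<delta> - h"] phi_minus[of "h - \<delta>"] phi_values_neg
  by (simp_all add: algebra_simps)

text \<open>With k = h/2, product-to-sum formulas reduce the claim to sin \<delta> sin (k -
  \<delta>/4) \<le> sin (\<delta> - 2k) sin (\<delta>/4 + k). For \<delta>/4 < k \<le> 3\<delta>/8
  the term sin (\<delta>/4) sin (\<delta>/2) separates the two sides.\<close>

lemma vertex_cos_ineq: "cos (5 * \<delta> / 4 - h / 2) \<le> cos h * cos (3 * \<delta> / 4 - h / 2)"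
proof -
  define k where "k = h / 2"
  have k: "\<delta> / 4 < k" "k \<le> 3 * \<delta> / 8" "h = 2 * k"
    using half_delta_less_h h_le by (auto simp: k_def)
  have d: "\<delta> < pi / 2" using delta_le pi_gt_zero by linarith
  have "sin \<delta> * sin (k - \<delta> / 4) \<le> sin \<delta> * sin (\<delta> / 8)"
    using k d delta_pos by (intro mult_left_mono sin_monotone_2pi_le sin_ge_zero) linarith+
  also have "\<dots> = 2 * (sin (\<delta> / 2) * sin (\<delta> / 8)) * cos (\<delta> / 2)"
    using sin_double[of "\<delta> / 2"] by simp
  also have "\<dots> \<le> 2 * (sin (\<delta> / 2) * sin (\<delta> / 8)) * cos (\<delta> / 8)"
    using d delta_pos by (intro mult_left_mono cos_monotone_0_pi_le mult_nonneg_nonneg sin_ge_zero) simp_all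
  also have "\<dots> = sin (\<delta> / 4) * sin (\<delta> / 2)"
    using sin_double[of "\<delta> / 8"] by simp
  also have "\<dots> \<le> sin (\<delta> - 2 * k) * sin (\<delta> / 4 + k)"
    using k d delta_pos
    by (intro mult_mono sin_monotone_2pi_le sin_ge_zero) linarith+
  finally have "sin \<delta> * sin (k - \<delta> / 4) \<le> sin (\<delta> - 2 * k) * sin (\<delta> / 4 + k)" .
  moreover have e1: "(3 * \<delta> / 4 + k + (5 * \<delta> / 4 - k)) / 2 = \<delta>"
    "(5 * \<delta> / 4 - k - (3 * \<delta> / 4 + k)) / 2 = \<delta> / 4 - k"
    by (simp_all add: field_simps)
  moreover have "cos (3 * \<delta> / 4 + k) - cos (5 * \<delta> / 4 - k) = - 2 * (sin \<delta> * sin (k - \<delta> / 4))"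
    using cos_diff_cos[of "3 * \<delta> / 4 + k" "5 * \<delta> / 4 - k"] sin_minus[of "\<delta> / 4 - k"]
    unfolding e1 by simp
  moreover have e2: "(3 * \<delta> / 4 - 3 * k + (5 * \<delta> / 4 - k)) / 2 = \<delta> - 2 * k"
    "(5 * \<delta> / 4 - k - (3 * \<delta> / 4 - 3 * k)) / 2 = \<delta> / 4 + k"
    by (simp_all add: field_simps)
  moreover have "cos (3 * \<delta> / 4 - 3 * k) - cos (5 * \<delta> / 4 - k) = 2 * (sin (\<delta> - 2 * k) * sin (\<delta> / 4 + k))"
    using cos_diff_cos[of "3 * \<delta> / 4 - 3 * k" "5 * \<delta> / 4 - k"]
    unfolding e2 by simp
  moreover have "2 * (cos (2 * k) * cos (3 * \<delta> / 4 - k)) = cos (3 * \<delta> / 4 - 3 * k) + cos (3 * \<delta> / 4 + k)"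
    using cos_times_cos[of "3 * \<delta> / 4 - k" "2 * k"] by (simp add: field_simps)
  ultimately show ?thesis unfolding k(3) by simp
qed

text \<open>Seen from the midpoint of side i, h-2\<delta> and 2\<delta>-h are Q_(i-1) and P_(i+2),
  while -\<delta>/2 and \<delta>/2 are the directions of V_i and V_(i+1). By the symmetry of
  \<open>phi_minus_compare\<close> both claims are the same inequality.\<close>

lemma phi_vertex: "\<phi> (h - 2 * \<delta>) \<le> \<delta> / 2" "\<phi> (- \<delta> / 2) \<le> 2 * \<delta> - h"
proof -
  have b: "0 < 2 * \<delta> - h + \<delta> / 2" "2 * \<delta> - h + \<delta> / 2 < 2 * pi"
    using h_pos h_less_delta delta_le pi_gt_zero by linarith+
  have e: "(2 * \<delta> - h + \<delta> / 2) / 2 = 5 * \<delta> / 4 - h / 2" "(2 * \<delta> - h - \<delta> / 2) / 2 = 3 * \<delta> / 4 - h / 2"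
    "(\<delta> / 2 - (2 * \<delta> - h)) / 2 = - (3 * \<delta> / 4 - h / 2)" "(\<delta> / 2 + (2 * \<delta> - h)) / 2 = 5 * \<delta> / 4 - h / 2"
    by (simp_all add: field_simps)
  show "\<phi> (h - 2 * \<delta>) \<le> \<delta> / 2"
    using phi_minus_compare(1)[OF b] vertex_cos_ineq unfolding e by simp
  show "\<phi> (- \<delta> / 2) \<le> 2 * \<delta> - h"
    using phi_minus_compare(1)[of "\<delta> / 2" "2 * \<delta> - h"] b vertex_cos_ineq unfolding e cos_minus by simp
qed

section \<open>Lifts of the generators\<close>

abbreviation \<sigma> :: "int \<Rightarrow> int" where "\<sigma> \<equiv> sigma g"

text \<open>The lift of T_i that sends the midpoint direction of side i to the direction opposite to
  side \<sigma>(i), half a turn ahead of \<open>\<mu> (\<sigma> i)\<close>.\<close>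

definition \<Phi> :: "int \<Rightarrow> real \<Rightarrow> real" where
  "\<Phi> i u = \<mu> (\<sigma> i) + \<phi> (u - \<mu> i)"

lemma sigma_sigma: "\<sigma> (\<sigma> i) = i"
  by (auto simp: sigma_def)

lemma sigma_add: "\<sigma> (i + N * r) = \<sigma> i - N * r"
  using even_N by (simp add: sigma_def)

lemma mu_add: "\<mu> (i + N * r) = \<mu> i + 2 * pi * of_int r"
proof -
  have "\<mu> (i + N * r) = \<mu> i + (real_of_int N * \<delta>) * of_int r"
    by (simp add: mu_eq algebra_simps)
  then show ?thesis by (simp add: N_delta)
qed

lemma cis_add_2pi: "cis (u + 2 * pi * of_int r) = cis u"
  by (simp flip: cis_mult)

lemma two_pi_int_less_iff: "2 * pi * of_int a < 2 * pi * of_int b \<longleftrightarrow> a < b" for a b :: int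
  by simp

lemma cis_eqE:
  assumes "cis u = cis v"
  obtains r :: int where "v = u + 2 * pi * of_int r"
proof -
  have "exp (\<i> * complex_of_real v) = exp (\<i> * complex_of_real u)"
    using assms by (simp add: cis_conv_exp)
  then obtain n :: int where "\<i> * complex_of_real v = \<i> * complex_of_real u + of_int (2 * n) * of_real pi * \<i>"
    unfolding exp_eq by (auto simp: algebra_simps)
  then have "Im (\<i> * complex_of_real v) = Im (\<i> * complex_of_real u + of_int (2 * n) * of_real pi * \<i>)"
    by simp
  then have "v = u + 2 * pi * of_int n" by simp
  then show thesis by (rule that)
qed

lemma cis_phi: "cis (\<phi> \<theta>) = (of_real R * cis \<theta> - 1) / (cis \<theta> - of_real R)"
proof -
  \<comment> \<open>L cis \<alpha> is the polar form of R - cis (-\<theta>). The numerator is cis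
    \<theta> times it and the denominator is minus its conjugate, so the quotient has argument pi +
    \<theta> + 2\<alpha>.\<close>
  define \<alpha> where "\<alpha> = arctan (sin \<theta> / (R - cos \<theta>))"
  define L where "L = (R - cos \<theta>) / cos \<alpha>"
  have ca: "cos \<alpha> > 0" using arctan_lbound arctan_ubound unfolding \<alpha>_def by (intro cos_gt_zero_pi) simp_all
  have L: "L > 0" using ca R_minus_cos_pos by (simp add: L_def)
  have "tan \<alpha> = sin \<theta> / (R - cos \<theta>)" by (simp add: \<alpha>_def tan_arctan)
  then have s: "L * sin \<alpha> = sin \<theta>" using ca R_minus_cos_pos[of \<theta>]
    by (simp add: L_def tan_def field_simps)
  have c: "L * cos \<alpha> = R - cos \<theta>" using ca by (simp add: L_def)
  have den: "cis \<theta> - of_real R = - (of_real L * cis (- \<alpha>))"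
    using s c by (simp add: complex_eq_iff)
  have "of_real R * cis \<theta> - 1 = cis \<theta> * (of_real R - cis (- \<theta>))"
    by (simp add: algebra_simps cis_mult)
  also have "of_real R - cis (- \<theta>) = of_real L * cis \<alpha>"
    using s c by (simp add: complex_eq_iff)
  finally have num: "of_real R * cis \<theta> - 1 = cis \<theta> * (of_real L * cis \<alpha>)" .
  have "cis (\<phi> \<theta>) * (cis \<theta> - of_real R) = of_real L * - cis (pi + \<theta> + \<alpha>)"
    unfolding den by (simp add: \<phi>_def \<alpha>_def[symmetric] cis_mult algebra_simps)
  also have "\<dots> = of_real R * cis \<theta> - 1"
    unfolding num minus_cis using cis_add_2pi[of "\<theta> + \<alpha>" 1] by (simp add: cis_mult algebra_simps)
  finally have "cis (\<phi> \<theta>) * (cis \<theta> - of_real R) = of_real R * cis \<theta> - 1" .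
  moreover have "cis \<theta> - of_real R \<noteq> 0" unfolding den using L by simp
  ultimately show ?thesis using nonzero_eq_divide_eq by blast
qed

lemma Tmap_cis: "Tmap g i (cis u) = cis (\<Phi> i u)"
proof -
  define \<theta> where "\<theta> = u - \<mu> i"
  define S where "S = \<mu> (\<sigma> i)"
  define M where "M = \<mu> i"
  define r where "r = rc g"
  have "r > 0" unfolding r_def rc_def using h_pos h_less_pi by (simp add: h_def tan_gt_zero)
  then have r: "complex_of_real (1 / r) \<noteq> 0" by simp
  have ring: "a * x * (b * y) + a * - b = a * b * (x * y - 1)"
    "a * (b * y) + a * x * - b = a * b * (y - x)" for a b x y :: complex
    by (simp_all add: algebra_simps)
  have num: "Ta g i * cis u + Tb g i =
      (of_real (1/r) * cis ((M + S) / 2 - pi / 2)) * (of_real R * cis \<theta> - 1)"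
  proof -
    have "cis ((S - M - pi) / 2) * cis u = cis ((M + S) / 2 - pi / 2) * cis \<theta>"
      by (simp only: cis_mult) (rule arg_cong[of _ _ cis], simp add: \<theta>_def M_def field_simps)
    moreover have "cis ((S + M + pi) / 2) = - cis ((M + S) / 2 - pi / 2)"
      by (simp only: minus_cis) (rule arg_cong[of _ _ cis], simp add: field_simps)
    moreover have "Ta g i * cis u = of_real (1/r) * of_real R * (cis ((S - M - pi) / 2) * cis u)"
      by (simp add: Ta_def S_def M_def \<mu>_def r_def R_def)
    moreover have "Tb g i = of_real (1/r) * cis ((S + M + pi) / 2)"
      by (simp add: Tb_def S_def M_def \<mu>_def r_def)
    ultimately show ?thesis by (simp only: ring)
  qed
  have den: "cnj (Tb g i) * cis u + cnj (Ta g i) =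
      (of_real (1/r) * cis ((M - S) / 2 - pi / 2)) * (cis \<theta> - of_real R)"
  proof -
    have "cis (- ((S + M + pi) / 2)) * cis u = cis ((M - S) / 2 - pi / 2) * cis \<theta>"
      by (simp only: cis_mult) (rule arg_cong[of _ _ cis], simp add: \<theta>_def M_def field_simps)
    moreover have "cis (- ((S - M - pi) / 2)) = - cis ((M - S) / 2 - pi / 2)"
      by (simp only: minus_cis) (rule arg_cong[of _ _ cis], simp add: field_simps)
    moreover have "cnj (Tb g i) * cis u = of_real (1/r) * (cis (- ((S + M + pi) / 2)) * cis u)"
      by (simp add: Tb_def S_def M_def \<mu>_def r_def cis_cnj)
    moreover have "cnj (Ta g i) = of_real (1/r) * of_real R * cis (- ((S - M - pi) / 2))"
      by (simp add: Ta_def S_def M_def \<mu>_def r_def R_def cis_cnj)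
    ultimately show ?thesis by (simp only: ring)
  qed
  have cS: "cis ((M + S) / 2 - pi / 2) = cis S * cis ((M - S) / 2 - pi / 2)"
    by (simp only: cis_mult) (rule arg_cong[of _ _ cis], simp add: field_simps)
  have cancel: "(a * (s * b) * x) / (a * b * y) = s * (x / y)" if "a \<noteq> 0" "b \<noteq> 0" for a b s x y :: complex
    using that by simp
  have "Tmap g i (cis u) = cis S * ((of_real R * cis \<theta> - 1) / (cis \<theta> - of_real R))"
    unfolding Tmap_def num den cS by (rule cancel[OF r cis_neq_zero])
  then show ?thesis by (simp add: cis_phi[symmetric] cis_mult \<Phi>_def S_def \<theta>_def)
qed

text \<open>Both \<open>\<sigma>\<close> and w -> (R w - 1)/(w - R) are involutions.\<close>

lemma Tmap_inverse: "Tmap g (\<sigma> i) (cis (\<Phi> i u)) = cis u"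
proof -
  define w where "w = cis (u - \<mu> i)"
  define r where "r = complex_of_real R"
  have "norm w \<noteq> norm r" using R_gt_1 by (simp add: w_def r_def)
  then have wR: "w - r \<noteq> 0" by auto
  have "r\<^sup>2 - 1 \<noteq> 0"
  proof -
    have "R\<^sup>2 - 1 > 0" using R_gt_1 by simp
    then have "complex_of_real (R\<^sup>2 - 1) \<noteq> 0" by (simp only: of_real_eq_0_iff)
    then show ?thesis by (simp add: r_def)
  qed
  have "cis (\<phi> (\<phi> (u - \<mu> i))) = (r * ((r * w - 1) / (w - r)) - 1) / ((r * w - 1) / (w - r) - r)"
    by (simp add: cis_phi w_def r_def)
  also have "r * ((r * w - 1) / (w - r)) - 1 = (r\<^sup>2 - 1) * w / (w - r)"
    using wR by (simp add: field_simps power2_eq_square)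
  also have "(r * w - 1) / (w - r) - r = (r\<^sup>2 - 1) / (w - r)"
    using wR by (simp add: field_simps power2_eq_square)
  finally have "cis (\<phi> (\<phi> (u - \<mu> i))) = w" using wR \<open>r\<^sup>2 - 1 \<noteq> 0\<close> by simp
  then show ?thesis
    unfolding Tmap_cis using cis_mult[of "\<mu> i" "u - \<mu> i"] by (simp add: \<Phi>_def sigma_sigma w_def flip: cis_mult)
qed

lemma cis_Phi_add: "cis (\<Phi> (i + N * r) (u + 2 * pi * of_int k)) = cis (\<Phi> i u)"
proof -
  \<comment> \<open>One \<open>r\<close> comes from recentring the argument at the shifted side, the
    other from \<open>\<sigma>\<close>, which reverses the shift.\<close>
  have "\<Phi> (i + N * r) (u + 2 * pi * of_int k) = \<Phi> i u + 2 * pi * of_int (k - 2 * r)"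
  proof -
    have "u + 2 * pi * of_int k - \<mu> (i + N * r) = (u - \<mu> i) + 2 * pi * of_int (k - r)"
      unfolding mu_add by (simp add: algebra_simps)
    moreover have "\<mu> (\<sigma> (i + N * r)) = \<mu> (\<sigma> i) - 2 * pi * of_int r"
      using mu_add[of "\<sigma> i" "- r"] by (simp add: sigma_add)
    ultimately show ?thesis by (simp only: \<Phi>_def phi_add) (simp add: algebra_simps)
  qed
  then show ?thesis by (simp only: cis_add_2pi)
qed

lemma Phi_le_iff: "\<Phi> i u \<le> \<Phi> i v \<longleftrightarrow> u \<le> v"
  by (simp add: \<Phi>_def phi_le_iff)

lemma Phi_add: "\<Phi> i (u + 2 * pi) = \<Phi> i u + 2 * pi" "\<Phi> i (u - 2 * pi) = \<Phi> i u - 2 * pi"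
  using phi_add[of "u - \<mu> i" 1] phi_add[of "u - \<mu> i" "-1"] by (simp_all add: \<Phi>_def algebra_simps)

subsection \<open>Symbolic coding by the arcs between consecutive endpoints\<close>

lemma p_eq: "p k = p 0 + of_int k * \<delta>" and q_eq: "q k = p k + (2 * h - \<delta>)"
  by (simp_all add: p_def q_def mu_eq algebra_simps)

lemma p_add_N: "p (k + N) = p k + 2 * pi" and q_add_N: "q (k + N) = q k + 2 * pi"
  using mu_add[of k 1] mu_add[of "k - 1" 1] by (simp_all add: p_def q_def algebra_simps)

text \<open>The arc \<open>[P\<^sub>k, Q\<^sub>k)\<close> carries the even code \<open>2 * k\<close>, the arc \<open>[Q\<^sub>k, P\<^bsub>k+1\<^esub>)\<close>
  the odd code \<open>2 * k + 1\<close>.\<close>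

definition idx :: "real \<Rightarrow> int" where
  "idx u = (let k = \<lfloor>(u - p 0) / \<delta>\<rfloor> in 2 * k + (if q k \<le> u then 1 else 0))"

lemma p_mono: "p k \<le> p l \<longleftrightarrow> k \<le> l"
  using delta_pos p_eq[of k] p_eq[of l] by simp

lemma q_mono: "q k \<le> q l \<longleftrightarrow> k \<le> l"
  by (simp add: q_eq p_mono)

lemma p_less_q: "p k < q k" and q_less_p: "q k < p (k + 1)"
  using half_delta_less_h h_less_delta p_eq[of k] p_eq[of "k+1"] by (simp_all add: q_eq algebra_simps)

text \<open>The dictionary that turns comparisons with endpoints into integer inequalities.\<close>

lemma idx_p: "2 * k \<le> idx u \<longleftrightarrow> p k \<le> u"
  and idx_q: "2 * k + 1 \<le> idx u \<longleftrightarrow> q k \<le> u"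
proof -
  define l where "l = \<lfloor>(u - p 0) / \<delta>\<rfloor>"
  have "of_int l \<le> (u - p 0) / \<delta>" "(u - p 0) / \<delta> < of_int l + 1"
    by (auto simp: l_def)
  then have l: "p l \<le> u" "u < p (l + 1)"
    using delta_pos p_eq[of l] p_eq[of "l+1"] by (simp_all add: field_simps)
  have i: "idx u = 2 * l + (if q l \<le> u then 1 else 0)" by (simp add: idx_def l_def Let_def)
  have pk: "p k \<le> u \<longleftrightarrow> k \<le> l" for k
    using l p_mono[of k l] p_mono[of "l + 1" k] by linarith
  show "2 * k \<le> idx u \<longleftrightarrow> p k \<le> u" unfolding i pk by (cases "q l \<le> u") (simp_all, presburger)
  show "2 * k + 1 \<le> idx u \<longleftrightarrow> q k \<le> u"
  proof (cases "q l \<le> u")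
    case True
    have "q k \<le> u \<longleftrightarrow> k \<le> l"
      using q_mono[of k l] q_mono[of "l + 1" k] p_less_q[of "l + 1"] l True by linarith
    then show ?thesis using True by (simp add: i)
  next
    case False
    have "q k \<le> u \<longleftrightarrow> k < l"
      using q_mono[of l k] q_less_p[of k] p_mono[of "k + 1" l] l False by linarith
    then show ?thesis using False by (simp add: i) presburger
  qed
qed

lemma idx_mono: "u \<le> v \<Longrightarrow> idx u \<le> idx v"
proof -
  assume "u \<le> v"
  then show ?thesis
    using idx_p[of "idx u div 2" u] idx_p[of "idx u div 2" v] idx_q[of "idx u div 2" u] idx_q[of "idx u div 2" v]
    by (cases "even (idx u)") auto
qed

lemma idx_add: "idx (u + 2 * pi * of_int r) = idx u + 2 * N * r"
proof -
  have e: "u + 2 * pi * of_int r - p 0 = (u - p 0) + of_int (N * r) * \<delta>"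
    using N_delta by (simp add: algebra_simps)
  have "(u + 2 * pi * of_int r - p 0) / \<delta> = (u - p 0) / \<delta> + of_int (N * r)"
    unfolding e add_divide_distrib using delta_pos by simp
  then have f: "\<lfloor>(u + 2 * pi * of_int r - p 0) / \<delta>\<rfloor> = \<lfloor>(u - p 0) / \<delta>\<rfloor> + N * r"
    by (simp only: floor_add_int)
  have q: "q (k + N * r) = q k + 2 * pi * of_int r" for k
    using mu_add[of "k - 1" r] by (simp add: q_def algebra_simps)
  show ?thesis unfolding idx_def f Let_def q by simp
qed

lemma idx_add_2pi: "idx (u + 2 * pi) = idx u + 2 * N" and idx_sub_2pi: "idx (u - 2 * pi) = idx u - 2 * N"
  using idx_add[of u 1] idx_add[of u "-1"] by simp_all

lemma idx_less_imp: "idx u < idx v \<Longrightarrow> u < v"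
  using idx_mono[of v u] by linarith

text \<open>These endpoints lie at angles -h, h and plus or minus \<delta>-h, \<delta>+h from the
  midpoint of side i, where \<open>\<phi>\<close> is known. The term \<open>N\<close> marks images
  that are a full turn ahead.\<close>

lemma Phi_p_q:
  "\<Phi> i (p (i - 1)) = p (\<sigma> i + 1)"
  "\<Phi> i (p i) = q (\<sigma> i + 1)"
  "\<Phi> i (q i) = q (\<sigma> i + 2)"
  "\<Phi> i (p (i + 1)) = p (\<sigma> i - 1 + N)"
  "\<Phi> i (q (i + 1)) = p (\<sigma> i + N)"
  "\<Phi> i (q (i + 2)) = q (\<sigma> i + N)"
proof -
  have l: "p (i - 1) - \<mu> i = - \<delta> - h" "p i - \<mu> i = - h" "q i - \<mu> i = h - \<delta>"
    "p (i + 1) - \<mu> i = \<delta> - h" "q (i + 1) - \<mu> i = h" "q (i + 2) - \<mu> i = \<delta> + h"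
    by (simp_all add: p_def q_def mu_eq algebra_simps)
  have r: "p (\<sigma> i + 1) = \<mu> (\<sigma> i) + (\<delta> - h)" "q (\<sigma> i + 1) = \<mu> (\<sigma> i) + h"
    "q (\<sigma> i + 2) = \<mu> (\<sigma> i) + (\<delta> + h)" "p (\<sigma> i - 1 + N) = \<mu> (\<sigma> i) + (2 * pi - \<delta> - h)"
    "p (\<sigma> i + N) = \<mu> (\<sigma> i) + (2 * pi - h)" "q (\<sigma> i + N) = \<mu> (\<sigma> i) + (2 * pi - \<delta> + h)"
    by (simp_all only: p_add_N q_add_N) (simp_all add: p_def q_def mu_eq algebra_simps)
  show "\<Phi> i (p (i - 1)) = p (\<sigma> i + 1)" "\<Phi> i (p i) = q (\<sigma> i + 1)" "\<Phi> i (q i) = q (\<sigma> i + 2)"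
    "\<Phi> i (p (i + 1)) = p (\<sigma> i - 1 + N)" "\<Phi> i (q (i + 1)) = p (\<sigma> i + N)" "\<Phi> i (q (i + 2)) = q (\<sigma> i + N)"
    by (simp_all only: \<Phi>_def l r phi_values_neg phi_values_pos)
qed

lemma idx_Phi:
  "2 * i - 2 \<le> idx u \<longleftrightarrow> 2 * \<sigma> i + 2 \<le> idx (\<Phi> i u)"
  "2 * i \<le> idx u \<longleftrightarrow> 2 * \<sigma> i + 3 \<le> idx (\<Phi> i u)"
  "2 * i + 1 \<le> idx u \<longleftrightarrow> 2 * \<sigma> i + 5 \<le> idx (\<Phi> i u)"
  "2 * i + 2 \<le> idx u \<longleftrightarrow> 2 * \<sigma> i - 2 + 2 * N \<le> idx (\<Phi> i u)"
  "2 * i + 3 \<le> idx u \<longleftrightarrow> 2 * \<sigma> i + 2 * N \<le> idx (\<Phi> i u)"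
  "2 * i + 5 \<le> idx u \<longleftrightarrow> 2 * \<sigma> i + 1 + 2 * N \<le> idx (\<Phi> i u)"
proof -
  note P = Phi_le_iff[of i _ u, symmetric]
  show "2 * i - 2 \<le> idx u \<longleftrightarrow> 2 * \<sigma> i + 2 \<le> idx (\<Phi> i u)"
    using idx_p[of "i - 1" u] idx_p[of "\<sigma> i + 1" "\<Phi> i u"] P[of "p (i - 1)"] unfolding Phi_p_q distrib_left right_diff_distrib by (simp add: ac_simps)
  show "2 * i \<le> idx u \<longleftrightarrow> 2 * \<sigma> i + 3 \<le> idx (\<Phi> i u)"
    using idx_p[of "i" u] idx_q[of "\<sigma> i + 1" "\<Phi> i u"] P[of "p i"] unfolding Phi_p_q distrib_left right_diff_distrib by (simp add: ac_simps)
  show "2 * i + 1 \<le> idx u \<longleftrightarrow> 2 * \<sigma> i + 5 \<le> idx (\<Phi> i u)"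
    using idx_q[of "i" u] idx_q[of "\<sigma> i + 2" "\<Phi> i u"] P[of "q i"] unfolding Phi_p_q distrib_left right_diff_distrib by (simp add: ac_simps)
  show "2 * i + 2 \<le> idx u \<longleftrightarrow> 2 * \<sigma> i - 2 + 2 * N \<le> idx (\<Phi> i u)"
    using idx_p[of "i + 1" u] idx_p[of "\<sigma> i - 1 + N" "\<Phi> i u"] P[of "p (i + 1)"] unfolding Phi_p_q distrib_left right_diff_distrib by (simp add: ac_simps)
  show "2 * i + 3 \<le> idx u \<longleftrightarrow> 2 * \<sigma> i + 2 * N \<le> idx (\<Phi> i u)"
    using idx_q[of "i + 1" u] idx_p[of "\<sigma> i + N" "\<Phi> i u"] P[of "q (i + 1)"] unfolding Phi_p_q distrib_left right_diff_distrib by (simp add: ac_simps)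
  show "2 * i + 5 \<le> idx u \<longleftrightarrow> 2 * \<sigma> i + 1 + 2 * N \<le> idx (\<Phi> i u)"
    using idx_q[of "i + 2" u] idx_q[of "\<sigma> i + N" "\<Phi> i u"] P[of "q (i + 2)"] unfolding Phi_p_q distrib_left right_diff_distrib by (simp add: ac_simps)
qed

text \<open>The same thresholds one turn later or earlier, for a coordinate whose lift is a turn
  away from side i.\<close>

lemma idx_Phi_periodic:
  "2 * i - 2 + 2 * N \<le> idx u \<longleftrightarrow> 2 * \<sigma> i + 2 + 2 * N \<le> idx (\<Phi> i u)"
  "2 * i + 2 * N \<le> idx u \<longleftrightarrow> 2 * \<sigma> i + 3 + 2 * N \<le> idx (\<Phi> i u)"
  "2 * i + 3 - 2 * N \<le> idx u \<longleftrightarrow> 2 * \<sigma> i \<le> idx (\<Phi> i u)"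
  "2 * i + 5 - 2 * N \<le> idx u \<longleftrightarrow> 2 * \<sigma> i + 1 \<le> idx (\<Phi> i u)"
  using idx_Phi(1)[of i "u - 2 * pi"] idx_Phi(2)[of i "u - 2 * pi"]
    idx_Phi(5)[of i "u + 2 * pi"] idx_Phi(6)[of i "u + 2 * pi"]
  unfolding Phi_add idx_add_2pi idx_sub_2pi by (simp_all add: algebra_simps)

subsection \<open>The Bowen--Series map on lifts\<close>

lemma ccw_angle_cis:
  assumes "a \<le> b" "b < a + 2 * pi"
  shows "ccw_angle (cis a) (cis b) = b - a"
proof (cases "b - a \<le> pi")
  case True
  then have "Arg (cis (b - a)) = b - a" using assms pi_gt_zero by (intro Arg_cis, unfold greaterThanAtMost_iff) linarith
  then show ?thesis using assms by (simp add: ccw_angle_def Let_def cis_divide)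
next
  case False
  have "cis (b - a) = cis (b - a - 2 * pi)" using cis_add_2pi[of "b - a" "-1"] by simp
  moreover have "Arg (cis (b - a - 2 * pi)) = b - a - 2 * pi"
    using assms False by (intro Arg_cis) auto
  ultimately show ?thesis using assms by (simp add: ccw_angle_def Let_def cis_divide)
qed

lemma cis_in_circ: "cis u \<in> circ"
  by (simp add: circ_def)

lemma cis_mem_arc_iff:
  "cis t \<in> arc_co (Pt g i) (Pt g (i + 1)) \<longleftrightarrow> (\<exists>r. i = idx t div 2 + N * r)"
proof -
  have Pt: "Pt g k = cis (p k)" for k by (simp add: Pt_def p_def \<mu>_def h_def)
  have dl: "p (i + 1) = p i + \<delta>" using p_eq[of i] p_eq[of "i+1"] by (simp add: algebra_simps)
  have d: "\<delta> < 2 * pi" using delta_le pi_gt_zero by linarith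
  \<comment> \<open>Moves \<open>t\<close> into the turn starting at \<open>p i\<close>, where the
    counterclockwise angle from P_i is a plain difference.\<close>
  define r where "r = - \<lfloor>(t - p i) / (2 * pi)\<rfloor>"
  define t' where "t' = t + 2 * pi * of_int r"
  have "of_int (- r) \<le> (t - p i) / (2 * pi)" "(t - p i) / (2 * pi) < of_int (- r) + 1"
    by (auto simp: r_def)
  then have t': "p i \<le> t'" "t' < p i + 2 * pi" by (simp_all add: t'_def field_simps)
  have c: "cis t = cis t'" by (simp add: t'_def cis_add_2pi)
  have i': "idx t' = idx t + 2 * N * r" by (simp add: t'_def idx_add)
  have "cis t \<in> arc_co (Pt g i) (Pt g (i + 1)) \<longleftrightarrow> t' < p (i + 1)"
    unfolding arc_co_def Pt c using t' delta_pos d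
    by (simp add: ccw_angle_cis cis_in_circ dl) linarith
  also have "\<dots> \<longleftrightarrow> i = idx t' div 2"
    using t' idx_p[of i t'] idx_p[of "i + 1" t'] by auto
  also have "\<dots> \<longleftrightarrow> i = idx t div 2 + N * r" by (simp add: i' mult.assoc add.commute)
  also have "\<dots> \<longleftrightarrow> (\<exists>r. i = idx t div 2 + N * r)"
  proof
    assume "\<exists>r. i = idx t div 2 + N * r"
    then obtain r' where r': "i = idx t div 2 + N * r'" by blast
    have 1: "2 * i \<le> idx t'" using t' idx_p by simp
    have "t' - 2 * pi < p i" using t' by simp
    then have "\<not> 2 * i \<le> idx (t' - 2 * pi)" using idx_p by simp
    then have 2: "idx t' < 2 * i + 2 * N" by (simp add: idx_sub_2pi)
    have a: "i + N * (r - r') = idx t' div 2" by (simp add: r' i' mult.assoc algebra_simps)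
    have "i \<le> idx t' div 2" "idx t' div 2 < i + N" using 1 2 by auto
    then have b: "0 \<le> N * (r - r')" "N * (r - r') < N * 1" using a by linarith+
    have "r - r' = 0" using b N_ge by (simp add: zero_le_mult_iff mult_less_cancel_left)
    then show "i = idx t div 2 + N * r" using r' by simp
  qed blast
  finally show ?thesis .
qed

lemma BS_map_cis:
  "BS_map g (cis s, cis t) = (cis (\<Phi> (idx t div 2) s), cis (\<Phi> (idx t div 2) t))"
proof -
  define j where "j = idx t div 2"
  \<comment> \<open>The representative of \<open>j\<close> modulo \<open>N\<close> among the side
    labels, which start at 1.\<close>
  define i where "i = (j - 1) mod N + 1"
  define r where "r = - ((j - 1) div N)"
  have Np: "N > 0" using N_ge by simp
  have ij: "i = j + N * r"
    using minus_mult_div_eq_mod[of "j - 1" N] by (simp add: i_def r_def)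
  have "(THE i. i \<in> {1..int (nsides g)} \<and> cis t \<in> arc_co (Pt g i) (Pt g (i + 1))) = i"
  proof (rule the_equality)
    show "i \<in> {1..int (nsides g)} \<and> cis t \<in> arc_co (Pt g i) (Pt g (i + 1))"
    proof
      show "i \<in> {1..int (nsides g)}"
        using pos_mod_bound[OF Np, of "j - 1"] pos_mod_sign[OF Np, of "j - 1"]
        unfolding i_def N_def[symmetric] atLeastAtMost_iff by linarith
      show "cis t \<in> arc_co (Pt g i) (Pt g (i + 1))"
        unfolding cis_mem_arc_iff using ij j_def by blast
    qed
    fix k assume k: "k \<in> {1..int (nsides g)} \<and> cis t \<in> arc_co (Pt g k) (Pt g (k + 1))"
    then obtain r' where "k = j + N * r'" by (auto simp: cis_mem_arc_iff j_def)
    then have "(k - 1) mod N = (j - 1) mod N"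
      using mod_mult_self2[of "j - 1" N r'] by (simp add: algebra_simps)
    moreover have "(k - 1) mod N = k - 1" using k by (intro mod_pos_pos_trivial) (auto simp: N_def)
    ultimately show "k = i" by (simp add: i_def)
  qed
  then have "BS_map g (cis s, cis t) = (Tmap g i (cis s), Tmap g i (cis t))"
    by (simp add: BS_map_def)
  then show ?thesis using cis_Phi_add[of j r _ 0] by (simp add: Tmap_cis ij j_def)
qed

subsection \<open>The bijectivity domain\<close>

text \<open>\<open>admissible (idx s) (idx t)\<close>, for lifts with \<open>t < s < t + 2 * pi\<close>, says that
  \<open>x = cis s\<close> lies in \<open>[Q\<^bsub>j+2\<^esub>, P\<^bsub>j-1\<^esub>)\<close> if \<open>y = cis t\<close> lies in \<open>[P\<^sub>j, Q\<^sub>j)\<close>, and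
  \<open>x\<close> lies in \<open>[Q\<^bsub>j+2\<^esub>, P\<^sub>j)\<close> if \<open>y\<close> lies in \<open>[Q\<^sub>j, P\<^bsub>j+1\<^esub>)\<close>.\<close>

definition admissible :: "int \<Rightarrow> int \<Rightarrow> bool" where
  "admissible m n \<longleftrightarrow>
     (if even n then n + 5 \<le> m \<and> m \<le> n - 3 + 2 * N else n + 4 \<le> m \<and> m \<le> n - 2 + 2 * N)"

definition \<Omega> :: "(complex \<times> complex) set" where
  "\<Omega> = {(cis s, cis t) |s t. admissible (idx s) (idx t)}"

lemma admissible_shift: "admissible (m + 2 * N * r) (n + 2 * N * r) \<longleftrightarrow> admissible m n"
  by (auto simp: admissible_def)

lemma admissible_bounds:
  assumes "admissible (idx s) (idx t)"
  shows "t < s" "s < t + 2 * pi"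
proof -
  have "idx t < idx s" "idx s < idx (t + 2 * pi)"
    using assms by (auto simp: admissible_def idx_add_2pi split: if_splits)
  then show "t < s" "s < t + 2 * pi" by (auto intro: idx_less_imp)
qed

text \<open>Lifts of a pair in this window are unique up to a common multiple of 2 pi, and
  \<open>admissible\<close> is invariant under that shift.\<close>

lemma cis_mem_Omega_iff:
  assumes "t < s" "s < t + 2 * pi"
  shows "(cis s, cis t) \<in> \<Omega> \<longleftrightarrow> admissible (idx s) (idx t)"
proof
  assume "(cis s, cis t) \<in> \<Omega>"
  then obtain s' t' where st: "cis s = cis s'" "cis t = cis t'" "admissible (idx s') (idx t')"
    by (auto simp: \<Omega>_def)
  obtain a where a: "s' = s + 2 * pi * of_int a" using st(1) by (rule cis_eqE)
  obtain b where b: "t' = t + 2 * pi * of_int b" using st(2) by (rule cis_eqE)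
  have "t' < s'" "s' < t' + 2 * pi" using admissible_bounds[OF st(3)] by auto
  then have "2 * pi * of_int (a - b) < 2 * pi * of_int 1" "2 * pi * of_int (- 1) < 2 * pi * of_int (a - b)"
    using assms by (simp_all add: a b algebra_simps)
  then have "a - b < 1" "- 1 < a - b" by (simp_all only: two_pi_int_less_iff)
  then have "a = b" by simp
  then show "admissible (idx s) (idx t)"
    using st(3) by (simp add: a b idx_add admissible_shift)
next
  assume "admissible (idx s) (idx t)"
  then show "(cis s, cis t) \<in> \<Omega>" by (auto simp: \<Omega>_def)
qed

lemma phase_lift:
  assumes "z \<in> phase"
  obtains s t where "z = (cis s, cis t)" "t < s" "s < t + 2 * pi"
proof -
  obtain x y where z: "z = (x, y)" "norm x = 1" "norm y = 1" "x \<noteq> y"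
    using assms by (auto simp: phase_def circ_def)
  define t where "t = Arg y"
  define a where "a = Arg x"
  have xy: "x = cis a" "y = cis t"
    unfolding a_def t_def using z(2,3) by (metis cis_Arg norm_zero sgn_eq zero_neq_one div_by_1 of_real_1)+
  have b: "- pi < a" "a \<le> pi" "- pi < t" "t \<le> pi"
    using Arg_bounded[of x] Arg_bounded[of y] by (auto simp: a_def t_def)
  have ne: "a \<noteq> t" using z xy by auto
  show thesis
  proof (cases "t < a")
    case True
    then show thesis using that[of a t] b xy z by auto
  next
    case False
    have "x = cis (a + 2 * pi)" using xy cis_add_2pi[of a 1] by simp
    then show thesis using that[of "a + 2 * pi" t] False ne b xy z by auto
  qed
qed

lemma Omega_subset_phase: "\<Omega> \<subseteq> phase"
proof
  fix z assume "z \<in> \<Omega>"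
  then obtain s t where st: "z = (cis s, cis t)" "admissible (idx s) (idx t)"
    by (auto simp: \<Omega>_def)
  have "cis s \<noteq> cis t"
  proof
    assume "cis s = cis t"
    then obtain r :: int where r: "t = s + 2 * pi * of_int r" by (rule cis_eqE)
    then have "2 * pi * of_int r < 2 * pi * of_int 0" "2 * pi * of_int (- 1) < 2 * pi * of_int r"
      using admissible_bounds[OF st(2)] by auto
    then have "r < 0" "- 1 < r" by (simp_all only: two_pi_int_less_iff)
    then show False by simp
  qed
  then show "z \<in> phase" using st(1) by (simp add: phase_def cis_in_circ)
qed

text \<open>The second claim puts the new x into the arc from Q_\<sigma>(j) to Q_(\<sigma>(j)+1), so
  the generator that was applied can be read off the image. Injectivity rests on this.\<close>

lemma admissible_forward:
  assumes "admissible (idx s) (idx t)" and j: "j = idx t div 2"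
  shows "admissible (idx (\<Phi> j s)) (idx (\<Phi> j t))"
    and "(idx (\<Phi> j s) - 1) div 2 = \<sigma> j + N"
proof -
  let ?m = "idx (\<Phi> j s)" and ?n = "idx (\<Phi> j t)"
  have "(even (idx t) \<and> idx t = 2 * j \<and> 2 * j + 5 \<le> idx s \<and> idx s < 2 * j - 2 + 2 * N)
     \<or> (odd (idx t) \<and> idx t = 2 * j + 1 \<and> 2 * j + 5 \<le> idx s \<and> idx s < 2 * j + 2 * N)"
    using assms by (auto simp: admissible_def elim!: evenE oddE split: if_splits)
  then have "admissible ?m ?n \<and> (?m - 1) div 2 = \<sigma> j + N"
  proof (elim disjE conjE)
    assume a: "idx t = 2 * j" "2 * j + 5 \<le> idx s" "idx s < 2 * j - 2 + 2 * N"
    have "2 * \<sigma> j + 3 \<le> ?n" "?n < 2 * \<sigma> j + 5" "?m = 2 * \<sigma> j + 1 + 2 * N"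
      using a idx_Phi(2,3)[of j t] idx_Phi(6)[of j s] idx_Phi_periodic(1)[of j s] by linarith+
    moreover from this have "?n = 2 * \<sigma> j + 3 \<or> ?n = 2 * \<sigma> j + 4" by linarith
    ultimately show ?thesis using N_ge by (auto simp: admissible_def)
  next
    assume a: "idx t = 2 * j + 1" "2 * j + 5 \<le> idx s" "idx s < 2 * j + 2 * N"
    have n: "2 * \<sigma> j + 5 \<le> ?n" "?n < 2 * \<sigma> j - 2 + 2 * N"
      and "2 * \<sigma> j + 1 + 2 * N \<le> ?m" "?m < 2 * \<sigma> j + 3 + 2 * N"
      using a idx_Phi(3,4)[of j t] idx_Phi(6)[of j s] idx_Phi_periodic(2)[of j s] by linarith+
    then have "?m = 2 * \<sigma> j + 1 + 2 * N \<or> ?m = 2 * \<sigma> j + 2 + 2 * N" by linarith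
    then show ?thesis using n N_ge unfolding admissible_def by presburger
  qed
  then show "admissible ?m ?n" "(?m - 1) div 2 = \<sigma> j + N" by auto
qed

text \<open>The second claim puts the new y into the arc from P_\<sigma>(k) to P_(\<sigma>(k)+1).
  There the map applies the inverse of T_k, which gives surjectivity.\<close>

lemma admissible_backward:
  assumes "admissible (idx s) (idx t)" and k: "k = (idx s - 1) div 2"
  shows "admissible (idx (\<Phi> k s)) (idx (\<Phi> k t))"
    and "idx (\<Phi> k t) div 2 = \<sigma> k"
proof -
  let ?m = "idx (\<Phi> k s)" and ?n = "idx (\<Phi> k t)"
  have "(idx s = 2 * k + 1 \<and> 2 * k + 3 - 2 * N \<le> idx t \<and> idx t < 2 * k - 2)
     \<or> (idx s = 2 * k + 2 \<and> 2 * k + 5 - 2 * N \<le> idx t \<and> idx t < 2 * k - 2)"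
    using assms unfolding admissible_def by presburger
  then have "admissible ?m ?n \<and> ?n div 2 = \<sigma> k"
  proof (elim disjE conjE)
    assume a: "idx s = 2 * k + 1" "2 * k + 3 - 2 * N \<le> idx t" "idx t < 2 * k - 2"
    have "2 * \<sigma> k + 5 \<le> ?m" "?m < 2 * \<sigma> k - 2 + 2 * N" "2 * \<sigma> k \<le> ?n" "?n < 2 * \<sigma> k + 2"
      using a idx_Phi(3,4)[of k s] idx_Phi(1)[of k t] idx_Phi_periodic(3)[of k t] by linarith+
    then show ?thesis using N_ge unfolding admissible_def by presburger
  next
    assume a: "idx s = 2 * k + 2" "2 * k + 5 - 2 * N \<le> idx t" "idx t < 2 * k - 2"
    have "2 * \<sigma> k - 2 + 2 * N \<le> ?m" "?m < 2 * \<sigma> k + 2 * N" "?n = 2 * \<sigma> k + 1"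
      using a idx_Phi(4,5)[of k s] idx_Phi(1)[of k t] idx_Phi_periodic(4)[of k t] by linarith+
    then show ?thesis using N_ge unfolding admissible_def by presburger
  qed
  then show "admissible ?m ?n" "?n div 2 = \<sigma> k" by auto
qed

lemma BS_map_Omega_bij: "bij_betw (BS_map g) \<Omega> \<Omega>"
proof (rule bij_betw_imageI)
  show "inj_on (BS_map g) \<Omega>"
  proof
    fix z w assume "z \<in> \<Omega>" "w \<in> \<Omega>" and eq: "BS_map g z = BS_map g w"
    then obtain s t s' t' where z: "z = (cis s, cis t)" "admissible (idx s) (idx t)"
      and w: "w = (cis s', cis t')" "admissible (idx s') (idx t')"
      by (auto simp: \<Omega>_def)
    define j where "j = idx t div 2"
    define j' where "j' = idx t' div 2"
    have e: "cis (\<Phi> j s) = cis (\<Phi> j' s')" "cis (\<Phi> j t) = cis (\<Phi> j' t')"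
      using eq by (simp_all add: z w BS_map_cis j_def j'_def)
    from e(1) obtain r where r: "\<Phi> j' s' = \<Phi> j s + 2 * pi * of_int r" by (rule cis_eqE)
    have "\<sigma> j' + N = (idx (\<Phi> j s) + 2 * N * r - 1) div 2"
      using admissible_forward(2)[OF w(2) j'_def] by (simp add: r idx_add)
    also have "\<dots> = (idx (\<Phi> j s) - 1) div 2 + N * r"
    proof -
      have "idx (\<Phi> j s) + 2 * N * r - 1 = (idx (\<Phi> j s) - 1) + 2 * (N * r)" by simp
      then show ?thesis by simp
    qed
    also have "\<dots> = \<sigma> j + N + N * r" using admissible_forward(2)[OF z(2) j_def] by simp
    finally have "\<sigma> j' = \<sigma> j + N * r" by simp
    \<comment> \<open>The inverse generators coincide because their indices differ by a multiple of
      \<open>N\<close>; applied to the equal images they recover both points.\<close>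
    then have T: "Tmap g (\<sigma> j') (cis u) = Tmap g (\<sigma> j) (cis u)" for u
      using cis_Phi_add[of "\<sigma> j" r u 0] by (simp add: Tmap_cis)
    have "cis s = cis s'" "cis t = cis t'"
      using Tmap_inverse[of j s] Tmap_inverse[of j t] Tmap_inverse[of j' s'] Tmap_inverse[of j' t'] e T
      by simp_all
    then show "z = w" by (simp add: z w)
  qed
  show "BS_map g ` \<Omega> = \<Omega>"
  proof (intro set_eqI iffI)
    fix z assume "z \<in> BS_map g ` \<Omega>"
    then obtain s t where "z = BS_map g (cis s, cis t)" "admissible (idx s) (idx t)"
      by (auto simp: \<Omega>_def)
    then show "z \<in> \<Omega>" using admissible_forward(1)[OF _ refl] by (auto simp: BS_map_cis \<Omega>_def)
  next
    fix z assume "z \<in> \<Omega>"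
    then obtain s t where z: "z = (cis s, cis t)" "admissible (idx s) (idx t)"
      by (auto simp: \<Omega>_def)
    define k where "k = (idx s - 1) div 2"
    have mem: "(cis (\<Phi> k s), cis (\<Phi> k t)) \<in> \<Omega>"
      using admissible_backward(1)[OF z(2) k_def] by (auto simp: \<Omega>_def)
    have "BS_map g (cis (\<Phi> k s), cis (\<Phi> k t)) = z"
      using Tmap_inverse[of k s] Tmap_inverse[of k t]
      by (simp add: BS_map_cis admissible_backward(2)[OF z(2) k_def] Tmap_cis z)
    then show "z \<in> BS_map g ` \<Omega>" using mem by force
  qed
qed

lemma Omega_rect: "finite_rect_structure \<Omega>"
proof -
  \<comment> \<open>Solves \<open>admissible\<close> for y: if x is in [P_k, P_(k+1)) the slice
    starts at Q_(k+1), and if x is in [Q_k, Q_(k+1)) it ends at P_(k-1), a turn ahead. Both bounds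
    are monotone in \<open>idx s\<close>, which takes finitely many values on a turn.\<close>
  define l where "l s = q (idx s div 2 + 1)" for s
  define u where "u s = p ((idx s - 1) div 2 - 1 + N)" for s
  define I where "I = {p 0..<p 0 + 2 * pi}"
  have ml: "mono_on I l"
    by (intro mono_onI) (simp add: l_def q_mono idx_mono zdiv_mono1)
  have mu: "mono_on I u"
    by (intro mono_onI) (simp add: u_def p_mono idx_mono zdiv_mono1 del: less_add_one zle_diff1_eq zle_add1_eq_le)
  have "idx ` I \<subseteq> {0..<2 * N}"
  proof
    fix m assume "m \<in> idx ` I"
    then obtain s where s: "m = idx s" "p 0 \<le> s" "s < p N" using p_add_N[of 0] by (auto simp: I_def)
    then show "m \<in> {0..<2 * N}" using idx_p[of 0 s] idx_p[of N s] by auto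
  qed
  then have "finite (idx ` I)" by (rule finite_subset) simp
  then have "finite ((\<lambda>m. q (m div 2 + 1)) ` idx ` I)" "finite ((\<lambda>m. p ((m - 1) div 2 - 1 + N)) ` idx ` I)"
    by auto
  then have fin: "finite (l ` I)" "finite (u ` I)" by (simp_all add: image_image l_def u_def)
  have mem: "(cis s, cis t) \<in> \<Omega> \<longleftrightarrow> l s \<le> t \<and> t < u s" if "s < t" "t < s + 2 * pi" for s t
  proof -
    \<comment> \<open>The rectangular structure lifts y above x, but \<open>admissible\<close> lifts
      x above y; hence the extra turn for x.\<close>
    have "(cis s, cis t) \<in> \<Omega> \<longleftrightarrow> (cis (s + 2 * pi), cis t) \<in> \<Omega>" using cis_add_2pi[of s 1] by simp
    also have "\<dots> \<longleftrightarrow> admissible (idx s + 2 * N) (idx t)"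
      using cis_mem_Omega_iff[of t "s + 2 * pi"] that by (simp add: idx_add_2pi)
    also have "\<dots> \<longleftrightarrow> 2 * (idx s div 2 + 1) + 1 \<le> idx t \<and> \<not> 2 * ((idx s - 1) div 2 - 1 + N) \<le> idx t"
      unfolding admissible_def by presburger
    also have "\<dots> \<longleftrightarrow> l s \<le> t \<and> t < u s" unfolding idx_p idx_q l_def u_def by auto
    finally show ?thesis .
  qed
  show ?thesis
    unfolding finite_rect_structure_def
    by (rule exI[of _ "p 0"], rule exI[of _ l], rule exI[of _ u], fold I_def)
      (intro conjI ballI ml mu fin; simp add: mem)
qed

subsection \<open>Attraction\<close>

definition absorbed :: "real \<Rightarrow> real \<Rightarrow> bool" where
  "absorbed s t \<longleftrightarrow> (\<exists>n. (BS_map g ^^ n) (cis s, cis t) \<in> \<Omega>)"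

lemma absorbed_admissible: "admissible (idx s) (idx t) \<Longrightarrow> absorbed s t"
  unfolding absorbed_def by (rule exI[of _ 0]) (auto simp: \<Omega>_def)

lemma absorbed_add: "absorbed (s + 2 * pi) t \<longleftrightarrow> absorbed s t"
  using cis_add_2pi[of s 1] by (simp add: absorbed_def)

lemma absorbed_admissible_add: "admissible (idx s + 2 * N) (idx t) \<Longrightarrow> absorbed s t"
  using absorbed_admissible[of "s + 2 * pi" t] by (simp add: absorbed_add idx_add_2pi)

lemma absorbed_step:
  assumes "absorbed (\<Phi> (idx t div 2) s) (\<Phi> (idx t div 2) t)"
  shows "absorbed s t"
proof -
  obtain n where "(BS_map g ^^ n) (BS_map g (cis s, cis t)) \<in> \<Omega>"
    using assms by (auto simp: absorbed_def BS_map_cis)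
  then have "(BS_map g ^^ Suc n) (cis s, cis t) \<in> \<Omega>" by (simp only: funpow_Suc_right o_apply)
  then show ?thesis unfolding absorbed_def by blast
qed

text \<open>The interval from \<open>p j\<close> to \<open>q (j + 1)\<close> is the arc inside the
  isometric circle of T_j. One constant serves all j because the generators share
  \<open>\<phi>\<close>.\<close>

lemma Phi_expansion:
  assumes "\<epsilon> > 0"
  obtains \<eta> where "\<eta> > 0"
    "\<And>j a b. p j \<le> a \<Longrightarrow> a + \<epsilon> \<le> b \<Longrightarrow> b \<le> q (j + 1) \<Longrightarrow> \<Phi> j b - \<Phi> j a \<ge> b - a + \<eta>"
proof -
  obtain \<eta> where e: "\<eta> > 0"
    "\<And>a b. - h \<le> a \<Longrightarrow> a + \<epsilon> \<le> b \<Longrightarrow> b \<le> h \<Longrightarrow> \<phi> b - \<phi> a \<ge> b - a + \<eta>"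
    using phi_expansion[OF assms] by blast
  show thesis
  proof (rule that[OF e(1)])
    fix j a b assume "p j \<le> a" "a + \<epsilon> \<le> b" "b \<le> q (j + 1)"
    then show "\<Phi> j b - \<Phi> j a \<ge> b - a + \<eta>"
      using e(2)[of "a - \<mu> j" "b - \<mu> j"] by (simp add: \<Phi>_def p_def q_def)
  qed
qed

lemma idx_div_2_bounds: "p (idx t div 2) \<le> t" "t < p (idx t div 2 + 1)"
  using idx_p[of "idx t div 2" t] idx_p[of "idx t div 2 + 1" t] by auto

lemma p_Suc: "p (j + 1) = p j + \<delta>"
  using p_eq[of j] p_eq[of "j + 1"] by (simp add: algebra_simps)

lemma p_le_q: "p (j + 1) \<le> q (j + 1)" "q j \<le> q (j + 1)"
  using p_less_q[of "j + 1"] q_mono[of j "j + 1"] by auto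

text \<open>Here \<open>x\<close> lies in \<open>[Q\<^bsub>j+1\<^esub>, Q\<^bsub>j+2\<^esub>)\<close>. While the orbit stays in such a position, the side
  pairings carry \<open>P\<^bsub>j+1\<^esub>\<close> to the next \<open>P\<^bsub>j+1\<^esub>\<close> and repel \<open>y\<close> from it.\<close>

lemma absorbed_right:
  assumes "idx s \<in> {2 * (idx t div 2) + 3, 2 * (idx t div 2) + 4}"
  shows "absorbed s t"
proof -
  define v where "v = (\<lambda>(s::real) t. p (idx t div 2 + 1) - t)"
  define \<epsilon> where "\<epsilon> = v s t"
  \<comment> \<open>The initial gap \<epsilon> is kept as a lower bound, so that one
    \<open>\<eta>\<close> works along the whole orbit.\<close>
  define P where "P = (\<lambda>s t. idx s \<in> {2 * (idx t div 2) + 3, 2 * (idx t div 2) + 4} \<and> \<epsilon> \<le> v s t)"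
  have "\<epsilon> > 0" using idx_div_2_bounds[of t] by (simp add: \<epsilon>_def v_def)
  then obtain \<eta> where "\<eta> > 0" and ex: "\<And>j a b. p j \<le> a \<Longrightarrow> a + \<epsilon> \<le> b \<Longrightarrow> b \<le> q (j + 1) \<Longrightarrow> \<Phi> j b - \<Phi> j a \<ge> b - a + \<eta>"
    using Phi_expansion by blast
  show ?thesis
  proof (rule growth_induct[where P = P and v = v and V = \<delta>, OF \<open>\<eta> > 0\<close>])
    show "P s t" using assms by (simp add: P_def \<epsilon>_def)
    show "v s t \<le> \<delta>" for s t using idx_div_2_bounds[of t] by (simp add: v_def p_Suc)
  next
    fix s t assume P: "P s t" and IH: "\<And>s' t'. P s' t' \<Longrightarrow> v s t + \<eta> \<le> v s' t' \<Longrightarrow> absorbed s' t'"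
    define j where "j = idx t div 2"
    let ?m = "idx (\<Phi> j s)" and ?n = "idx (\<Phi> j t)"
    have a: "2 * j \<le> idx t" "idx t < 2 * j + 2" "2 * j + 3 \<le> idx s" "idx s < 2 * j + 5" "\<epsilon> \<le> v s t"
      using P by (auto simp: P_def j_def)
    then have n: "2 * \<sigma> j + 3 \<le> ?n" "?n < 2 * \<sigma> j - 2 + 2 * N" and m: "?m = 2 * \<sigma> j + 2 * N"
      using idx_Phi(2,4)[of j t] idx_Phi(5,6)[of j s] by linarith+
    have "absorbed (\<Phi> j s) (\<Phi> j t)"
    proof (cases "?n \<le> 2 * \<sigma> j + 2 * N - 5")
      case True
      then have "admissible ?m ?n" using n m unfolding admissible_def by presburger
      then show ?thesis by (rule absorbed_admissible)
    next
      case False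
      \<comment> \<open>Only the codes of the arc from P_(\<sigma>(j)-2) to P_(\<sigma>(j)-1), a
        turn ahead, are left for y, so the same relative position recurs.\<close>
      then have j': "?n div 2 = \<sigma> j + N - 2" using n by presburger
      have v': "v (\<Phi> j s) (\<Phi> j t) = \<Phi> j (p (j + 1)) - \<Phi> j t"
      proof -
        have "\<sigma> j + N - 2 + 1 = \<sigma> j - 1 + N" by simp
        then show ?thesis by (simp only: v_def j' Phi_p_q)
      qed
      have "v s t + \<eta> \<le> v (\<Phi> j s) (\<Phi> j t)"
        unfolding v' using ex[of j t "p (j + 1)"] idx_div_2_bounds[of t] a(5) p_le_q[of j]
        by (simp add: v_def j_def)
      moreover from this have "P (\<Phi> j s) (\<Phi> j t)"
        using a(5) \<open>\<eta> > 0\<close> unfolding P_def j' m by simp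
      ultimately show ?thesis by (rule IH[rotated])
    qed
    then show "absorbed s t" unfolding j_def by (rule absorbed_step)
  qed
qed

text \<open>Here \<open>x\<close> lies in \<open>[P\<^bsub>j-1\<^esub>, Q\<^bsub>j-1\<^esub>)\<close> and \<open>y\<close> in \<open>[P\<^sub>j, Q\<^sub>j)\<close>. While the orbit stays in such a
  position, \<open>y\<close> is repelled from \<open>Q\<^sub>j\<close>; when it leaves, \<open>phi_vertex\<close> puts it into
  the domain after one more step.\<close>

lemma absorbed_left_strict:
  assumes "idx t = 2 * (idx t div 2)" "idx s = 2 * (idx t div 2) - 2"
  shows "absorbed s t"
proof -
  define v where "v = (\<lambda>(s::real) t. q (idx t div 2) - t)"
  define \<epsilon> where "\<epsilon> = v s t"
  define P where "P = (\<lambda>s t. idx t = 2 * (idx t div 2) \<and> idx s = 2 * (idx t div 2) - 2 \<and> \<epsilon> \<le> v s t)"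
  have "\<epsilon> > 0" using idx_q[of "idx t div 2" t] assms(1) by (simp add: \<epsilon>_def v_def)
  then obtain \<eta> where "\<eta> > 0" and ex: "\<And>j a b. p j \<le> a \<Longrightarrow> a + \<epsilon> \<le> b \<Longrightarrow> b \<le> q (j + 1) \<Longrightarrow> \<Phi> j b - \<Phi> j a \<ge> b - a + \<eta>"
    using Phi_expansion by blast
  show ?thesis
  proof (rule growth_induct[where P = P and v = v and V = \<delta>, OF \<open>\<eta> > 0\<close>])
    show "P s t" using assms by (simp add: P_def \<epsilon>_def)
    show "v s t \<le> \<delta>" for s t
      using idx_div_2_bounds[of t] q_less_p[of "idx t div 2"] by (simp add: v_def p_Suc)
  next
    fix s t assume P: "P s t" and IH: "\<And>s' t'. P s' t' \<Longrightarrow> v s t + \<eta> \<le> v s' t' \<Longrightarrow> absorbed s' t'"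
    define j where "j = idx t div 2"
    let ?s = "\<Phi> j s" and ?t = "\<Phi> j t"
    have a: "idx t = 2 * j" "idx s = 2 * j - 2" "\<epsilon> \<le> v s t"
      using P by (auto simp: P_def j_def)
    have n: "idx ?t = 2 * \<sigma> j + 3 \<or> idx ?t = 2 * \<sigma> j + 4" and m: "idx ?s = 2 * \<sigma> j + 2"
      using a idx_Phi(2,3)[of j t] idx_Phi(1,2)[of j s] by linarith+
    have "s < q (j - 1)" using a idx_q[of "j - 1" s] by simp
    then have "s - \<mu> j < h - 2 * \<delta>" by (simp add: q_def mu_eq algebra_simps)
    then have "\<phi> (s - \<mu> j) < \<phi> (h - 2 * \<delta>)" by (rule phi_strict_mono)
    \<comment> \<open>The new x lies before the direction of V_(\<sigma>(j)+1), here measured from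
      the midpoint of the side starting at that vertex.\<close>
    then have s': "?s - \<mu> (\<sigma> j + 1) < - \<delta> / 2"
      using phi_vertex(1) by (simp add: \<Phi>_def mu_eq algebra_simps)
    have "absorbed ?s ?t"
      using n
    proof
      assume n3: "idx ?t = 2 * \<sigma> j + 3"
      \<comment> \<open>Now y has entered [Q_b, P_(b+1)), so T_b comes next. It takes x to a point
        before P_(\<sigma>(b)+2) and y to Q_(\<sigma>(b)+2) or beyond, which is admissible.\<close>
      define b where "b = \<sigma> j + 1"
      have b: "idx ?t div 2 = b" "idx ?t = 2 * b + 1" "idx ?s = 2 * b" using n3 m by (auto simp: b_def)
      have "\<Phi> b ?s < \<mu> (\<sigma> b) + \<phi> (- \<delta> / 2)" using phi_strict_mono[OF s'] by (simp add: \<Phi>_def b_def)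
      also have "\<dots> \<le> p (\<sigma> b + 2)" using phi_vertex(2) by (simp add: p_def mu_eq algebra_simps)
      finally have "idx (\<Phi> b ?s) < 2 * \<sigma> b + 4" using idx_p[of "\<sigma> b + 2" "\<Phi> b ?s"] by auto
      then have "idx (\<Phi> b ?s) = 2 * \<sigma> b + 3"
        "2 * \<sigma> b + 5 \<le> idx (\<Phi> b ?t)" "idx (\<Phi> b ?t) < 2 * \<sigma> b - 2 + 2 * N"
        using b idx_Phi(2)[of b ?s] idx_Phi(3,4)[of b ?t] by linarith+
      then have "admissible (idx (\<Phi> b ?s) + 2 * N) (idx (\<Phi> b ?t))"
        unfolding admissible_def by presburger
      then have "absorbed (\<Phi> b ?s) (\<Phi> b ?t)" by (rule absorbed_admissible_add)
      then show ?thesis unfolding b(1)[symmetric] by (rule absorbed_step)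
    next
      assume n4: "idx ?t = 2 * \<sigma> j + 4"
      then have j': "idx ?t div 2 = \<sigma> j + 2" by simp
      have v': "v ?s ?t = \<Phi> j (q j) - \<Phi> j t"
        by (simp add: v_def j' Phi_p_q)
      have "v s t + \<eta> \<le> v ?s ?t"
        unfolding v' using ex[of j t "q j"] idx_div_2_bounds[of t] a(3) p_le_q[of j]
        by (simp add: v_def j_def)
      moreover from this have "P ?s ?t"
        using a(3) \<open>\<eta> > 0\<close> unfolding P_def j' m n4 by simp
      ultimately show ?thesis by (rule IH[rotated])
    qed
    then show "absorbed s t" unfolding j_def by (rule absorbed_step)
  qed
qed

text \<open>Here x is in [P_j, Q_j) and y in [Q_j, P_(j+1)). T_j expands their gap, so this position
  cannot recur forever; its only other outcomes are the domain and the position of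
  \<open>absorbed_left_strict\<close>.\<close>

lemma absorbed_across:
  assumes "idx t = idx s + 1" "even (idx s)"
  shows "absorbed s t"
proof -
  define \<epsilon> where "\<epsilon> = t - s"
  define P where "P = (\<lambda>s t. idx t = idx s + 1 \<and> even (idx s) \<and> \<epsilon> \<le> t - s)"
  have "\<epsilon> > 0" using idx_less_imp[of s t] assms(1) by (simp add: \<epsilon>_def)
  then obtain \<eta> where "\<eta> > 0" and ex: "\<And>j a b. p j \<le> a \<Longrightarrow> a + \<epsilon> \<le> b \<Longrightarrow> b \<le> q (j + 1) \<Longrightarrow> \<Phi> j b - \<Phi> j a \<ge> b - a + \<eta>"
    using Phi_expansion by blast
  have P_bounds: "idx s = 2 * (idx t div 2)" "idx t = 2 * (idx t div 2) + 1" "p (idx t div 2) \<le> s"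
    if "P s t" for s t
  proof -
    have "idx t = idx s + 1" "even (idx s)" using that by (simp_all add: P_def)
    then show "idx s = 2 * (idx t div 2)" "idx t = 2 * (idx t div 2) + 1" by presburger+
    then show "p (idx t div 2) \<le> s" using idx_p[of "idx t div 2" s] by simp
  qed
  show ?thesis
  proof (rule growth_induct[where P = P and v = "\<lambda>s t. t - s" and V = \<delta>, OF \<open>\<eta> > 0\<close>])
    show "P s t" using assms by (simp add: P_def \<epsilon>_def)
    show "t - s \<le> \<delta>" if "P s t" for s t
      using idx_div_2_bounds[of t] P_bounds[OF that] by (simp add: p_Suc)
  next
    fix s t assume P: "P s t" and IH: "\<And>s' t'. P s' t' \<Longrightarrow> t - s + \<eta> \<le> t' - s' \<Longrightarrow> absorbed s' t'"
    define j where "j = idx t div 2"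
    let ?m = "idx (\<Phi> j s)" and ?n = "idx (\<Phi> j t)"
    have a: "idx s = 2 * j" "idx t = 2 * j + 1" "p j \<le> s" "\<epsilon> \<le> t - s"
      using P P_bounds[OF P] by (auto simp: P_def j_def)
    have n: "2 * \<sigma> j + 5 \<le> ?n" "?n < 2 * \<sigma> j - 2 + 2 * N" and m: "?m = 2 * \<sigma> j + 3 \<or> ?m = 2 * \<sigma> j + 4"
      using a idx_Phi(3,4)[of j t] idx_Phi(2,3)[of j s] by linarith+
    have "absorbed (\<Phi> j s) (\<Phi> j t)"
    proof (cases "admissible (?m + 2 * N) ?n")
      case True
      then show ?thesis by (rule absorbed_admissible_add)
    next
      case False
      then have "?m = 2 * \<sigma> j + 4" "?n = 2 * \<sigma> j + 5 \<or> ?n = 2 * \<sigma> j + 6"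
        using m n N_ge unfolding admissible_def by presburger+
      then consider "?m = 2 * \<sigma> j + 4" "?n = 2 * \<sigma> j + 5" | "?m = 2 * \<sigma> j + 4" "?n = 2 * \<sigma> j + 6" by blast
      then show ?thesis
      proof cases
        case 1
        have "t - s + \<eta> \<le> \<Phi> j t - \<Phi> j s"
          using ex[of j s t] a(3,4) idx_div_2_bounds(2)[of t, folded j_def] p_le_q[of j] by linarith
        moreover from this have "P (\<Phi> j s) (\<Phi> j t)" using 1 a(4) \<open>\<eta> > 0\<close> by (simp add: P_def)
        ultimately show ?thesis by (rule IH[rotated])
      next
        case 2
        then show ?thesis by (intro absorbed_left_strict) simp_all
      qed
    qed
    then show "absorbed s t" unfolding j_def by (rule absorbed_step)
  qed
qed

text \<open>One step takes x into [P_(\<sigma>(j)+1), Q_(\<sigma>(j)+1)) and y one or two codes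
  further, which are the two preceding situations.\<close>

lemma absorbed_left:
  assumes "idx t = 2 * j" "idx s \<in> {2 * j - 2, 2 * j - 1}"
  shows "absorbed s t"
proof -
  let ?m = "idx (\<Phi> j s)" and ?n = "idx (\<Phi> j t)"
  have a: "2 * j - 2 \<le> idx s" "idx s < 2 * j" using assms by auto
  have "?m = 2 * \<sigma> j + 2" "?n = 2 * \<sigma> j + 3 \<or> ?n = 2 * \<sigma> j + 4"
    using a assms(1) idx_Phi(2,3)[of j t] idx_Phi(1,2)[of j s] by linarith+
  then have "absorbed (\<Phi> j s) (\<Phi> j t)"
    using absorbed_across[of "\<Phi> j t" "\<Phi> j s"] absorbed_left_strict[of "\<Phi> j t" "\<Phi> j s"] by auto
  then show ?thesis using absorbed_step[of t s] assms(1) by simp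
qed

text \<open>Both points lie in [P_j, Q_(j+1)), so their gap grows until x leaves that arc of the
  current side. It then lands either in the strip of \<open>absorbed_right\<close> or in the
  domain.\<close>

lemma absorbed_near_right:
  assumes "t < s" "idx s \<le> 2 * (idx t div 2) + 2"
  shows "absorbed s t"
proof -
  define \<epsilon> where "\<epsilon> = s - t"
  define P where "P = (\<lambda>s t. idx s \<le> 2 * (idx t div 2) + 2 \<and> \<epsilon> \<le> s - t)"
  have "\<epsilon> > 0" using assms(1) by (simp add: \<epsilon>_def)
  then obtain \<eta> where "\<eta> > 0" and ex: "\<And>j a b. p j \<le> a \<Longrightarrow> a + \<epsilon> \<le> b \<Longrightarrow> b \<le> q (j + 1) \<Longrightarrow> \<Phi> j b - \<Phi> j a \<ge> b - a + \<eta>"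
    using Phi_expansion by blast
  have P_bounds: "s < q (idx t div 2 + 1)" if "P s t" for s t
    using that idx_q[of "idx t div 2 + 1" s] unfolding P_def by auto
  show ?thesis
  proof (rule growth_induct[where P = P and v = "\<lambda>s t. s - t" and V = "2 * \<delta>", OF \<open>\<eta> > 0\<close>])
    show "P s t" using assms by (simp add: P_def \<epsilon>_def)
    show "s - t \<le> 2 * \<delta>" if "P s t" for s t
      using idx_div_2_bounds[of t] P_bounds[OF that] q_less_p[of "idx t div 2 + 1"] p_Suc[of "idx t div 2"]
        p_Suc[of "idx t div 2 + 1"] by linarith
  next
    fix s t assume P: "P s t" and IH: "\<And>s' t'. P s' t' \<Longrightarrow> s - t + \<eta> \<le> s' - t' \<Longrightarrow> absorbed s' t'"
    define j where "j = idx t div 2"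
    let ?m = "idx (\<Phi> j s)" and ?n = "idx (\<Phi> j t)"
    have a: "idx s < 2 * j + 3" "2 * j \<le> idx t" "idx t < 2 * j + 2" "s < q (j + 1)" "\<epsilon> \<le> s - t"
      using P P_bounds[OF P] by (auto simp: P_def j_def)
    have n: "2 * \<sigma> j + 3 \<le> ?n" "?n < 2 * \<sigma> j - 2 + 2 * N" "?m < 2 * \<sigma> j + 2 * N"
      using a idx_Phi(2,4)[of j t] idx_Phi(5)[of j s] by linarith+
    have "absorbed (\<Phi> j s) (\<Phi> j t)"
    proof (cases "?m \<le> 2 * (?n div 2) + 2")
      case True
      have "s - t + \<eta> \<le> \<Phi> j s - \<Phi> j t"
        using ex[of j t s] a idx_div_2_bounds[of t] by (simp add: j_def)
      moreover from this have "P (\<Phi> j s) (\<Phi> j t)" using True a(5) \<open>\<eta> > 0\<close> by (simp add: P_def)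
      ultimately show ?thesis by (rule IH[rotated])
    next
      case far: False
      show ?thesis
      proof (cases "?m \<in> {2 * (?n div 2) + 3, 2 * (?n div 2) + 4}")
        case True
        then show ?thesis by (rule absorbed_right)
      next
        case False
        then have "2 * (?n div 2) + 5 \<le> ?m" using far by auto
        then have "admissible ?m ?n" using n unfolding admissible_def by presburger
        then show ?thesis by (rule absorbed_admissible)
      qed
    qed
    then show "absorbed s t" unfolding j_def by (rule absorbed_step)
  qed
qed

text \<open>The mirror case: both points lie in [P_j, P_(j+1)) with x behind y. On leaving, x is in
  the strip of \<open>absorbed_left\<close> or, after adding a turn, the pair is admissible.\<close>

lemma absorbed_near_left:
  assumes "s < t" "2 * (idx t div 2) \<le> idx s"
  shows "absorbed s t"
proof -
  define \<epsilon> where "\<epsilon> = t - s"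
  define P where "P = (\<lambda>s t. 2 * (idx t div 2) \<le> idx s \<and> \<epsilon> \<le> t - s)"
  have "\<epsilon> > 0" using assms(1) by (simp add: \<epsilon>_def)
  then obtain \<eta> where "\<eta> > 0" and ex: "\<And>j a b. p j \<le> a \<Longrightarrow> a + \<epsilon> \<le> b \<Longrightarrow> b \<le> q (j + 1) \<Longrightarrow> \<Phi> j b - \<Phi> j a \<ge> b - a + \<eta>"
    using Phi_expansion by blast
  have P_bounds: "p (idx t div 2) \<le> s" if "P s t" for s t
    using that idx_p[of "idx t div 2" s] unfolding P_def by auto
  show ?thesis
  proof (rule growth_induct[where P = P and v = "\<lambda>s t. t - s" and V = \<delta>, OF \<open>\<eta> > 0\<close>])
    show "P s t" using assms by (simp add: P_def \<epsilon>_def)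
    show "t - s \<le> \<delta>" if "P s t" for s t
      using idx_div_2_bounds[of t] P_bounds[OF that] p_Suc[of "idx t div 2"] by linarith
  next
    fix s t assume P: "P s t" and IH: "\<And>s' t'. P s' t' \<Longrightarrow> t - s + \<eta> \<le> t' - s' \<Longrightarrow> absorbed s' t'"
    define j where "j = idx t div 2"
    let ?m = "idx (\<Phi> j s)" and ?n = "idx (\<Phi> j t)"
    have a: "2 * j \<le> idx s" "2 * j \<le> idx t" "idx t < 2 * j + 2" "p j \<le> s" "\<epsilon> \<le> t - s"
      using P P_bounds[OF P] by (auto simp: P_def j_def)
    have n: "2 * \<sigma> j + 3 \<le> ?m" "?n < 2 * \<sigma> j - 2 + 2 * N"
      using a idx_Phi(4)[of j t] idx_Phi(2)[of j s] by linarith+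
    have "absorbed (\<Phi> j s) (\<Phi> j t)"
    proof (cases "2 * (?n div 2) \<le> ?m")
      case True
      have "t - s + \<eta> \<le> \<Phi> j t - \<Phi> j s"
        using ex[of j s t] a idx_div_2_bounds[of t] p_le_q[of j] by (simp add: j_def)
      moreover from this have "P (\<Phi> j s) (\<Phi> j t)" using True a(5) \<open>\<eta> > 0\<close> by (simp add: P_def)
      ultimately show ?thesis by (rule IH[rotated])
    next
      case far: False
      show ?thesis
      proof (cases "even ?n \<and> ?m \<in> {?n - 2, ?n - 1}")
        case True
        then show ?thesis using absorbed_left[of "\<Phi> j t" "?n div 2" "\<Phi> j s"] by simp
      next
        case False
        then have "admissible (?m + 2 * N) ?n" using n far unfolding admissible_def by auto presburger+
        then show ?thesis by (rule absorbed_admissible_add)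
      qed
    qed
    then show "absorbed s t" unfolding j_def by (rule absorbed_step)
  qed
qed

text \<open>Counterclockwise from y, the point x meets the near right zone, the strip [Q_(j+1),
  Q_(j+2)), the domain, the strip [P_(j-1), P_j) if y is in [P_j, Q_j), and the near left zone. For
  the last two its lift is lowered by a turn.\<close>

lemma absorbed_all:
  assumes "t < s" "s < t + 2 * pi"
  shows "absorbed s t"
proof -
  define j where "j = idx t div 2"
  let ?m = "idx s" and ?n = "idx t"
  consider "?m \<le> 2 * j + 2" | "?m \<in> {2 * j + 3, 2 * j + 4}" | "2 * j \<le> ?m - 2 * N"
    | "even ?n" "?m - 2 * N \<in> {2 * j - 2, 2 * j - 1}" | "admissible ?m ?n"
  proof -
    have "?n = 2 * j \<and> even ?n \<or> ?n = 2 * j + 1 \<and> odd ?n" unfolding j_def by presburger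
    then show thesis using that unfolding admissible_def by fastforce
  qed
  then show ?thesis
  proof cases
    case 1
    then show ?thesis using absorbed_near_right assms by (simp add: j_def)
  next
    case 2
    then show ?thesis using absorbed_right by (simp add: j_def)
  next
    case 3
    then have "absorbed (s - 2 * pi) t" using assms
      by (intro absorbed_near_left) (simp_all add: j_def idx_sub_2pi)
    then show ?thesis using absorbed_add[of "s - 2 * pi" t] by simp
  next
    case 4
    then have "absorbed (s - 2 * pi) t"
      by (intro absorbed_left[of t j]) (simp_all add: j_def idx_sub_2pi)
    then show ?thesis using absorbed_add[of "s - 2 * pi" t] by simp
  next
    case 5
    then show ?thesis by (rule absorbed_admissible)
  qed
qed

end

theorem theorem2p1:
  fixes g :: nat
  assumes "g \<ge> 2"
  shows "\<exists>\<Omega>. \<Omega> \<subseteq> phase \<and> bij_betw (BS_map g) \<Omega> \<Omega> \<and> finite_rect_structure \<Omega> \<and>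
           (\<forall>p \<in> phase. \<exists>n. (BS_map g ^^ n) p \<in> \<Omega>)"
proof -
  interpret bowen_series g using assms by unfold_locales
  have "\<exists>n. (BS_map g ^^ n) z \<in> \<Omega>" if "z \<in> phase" for z
    using phase_lift[OF that] absorbed_all unfolding absorbed_def by metis
  then show ?thesis
    using Omega_subset_phase BS_map_Omega_bij Omega_rect by blast
qed

end
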